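(* Let $m,p,n\geq 1$ be integers, let $\mathcal{A}_1,\dots,\mathcal{A}_n\in\mathbb{C}^{m\times m\times p}$ be fixed (deterministic) Hermitian T-product tensors, and let $\alpha_1,\dots,\alpha_n$ be independent standard normal random variables. Define $\sigma^2=\left\Vert \sum_{i=1}^n \mathcal{A}_i^2\right\Vert$. Then for all $\theta\geq 0$, $$\Pr\left(\lambda_{\max}\left(\sum_{i=1}^n \alpha_i\mathcal{A}_i\right)\geq\theta\right)\leq mp\, e^{-\theta^2/(2\sigma^2)}$$ and $$\Pr\left(\left\Vert\sum_{i=1}^n \alpha_i\mathcal{A}_i\right\Vert\geq\theta\right)\leq 2mp\, e^{-\theta^2/(2\sigma^2)}.$$ Both inequalities also hold when $\alpha_1,\dots,\alpha_n$ are instead independent Rademacher random variables.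
   Context: For $\mathcal{A}\in\mathbb{C}^{m\times n\times p}$ with frontal slices $A^{(1)},\dots,A^{(p)}\in\mathbb{C}^{m\times n}$, $\mathrm{bcirc}(\mathcal{A})\in\mathbb{C}^{mp\times np}$ is the block circulant matrix whose $(r,s)$ block ($1\le r,s\le p$) is $A^{(((r-s)\bmod p)+1)}$. The T-product of $\mathcal{A}\in\mathbb{C}^{m\times n\times p}$ and $\mathcal{B}\in\mathbb{C}^{n\times q\times p}$ is the unique $\mathcal{A}\star\mathcal{B}\in\mathbb{C}^{m\times q\times p}$ with $\mathrm{bcirc}(\mathcal{A}\star\mathcal{B})=\mathrm{bcirc}(\mathcal{A})\,\mathrm{bcirc}(\mathcal{B})$. The conjugate transpose $\mathcal{A}^{\mathrm H}\in\mathbb{C}^{n\times m\times p}$ is obtained by conjugate-transposing every frontal slice and reversing the order of slices $2,\dots,p$, so $\mathrm{bcirc}(\mathcal{A}^{\mathrm H})=\mathrm{bcirc}(\mathcal{A})^{\mathrm H}$. A tensor $\mathcal{A}\in\mathbb{C}^{m\times m\times p}$ is a Hermitian T-product tensor if $\mathcal{A}^{\mathrm H}=\mathcal{A}$; its eigenvalues are the $mp$ real eigenvalues of the Hermitian matrix $\mathrm{bcirc}(\mathcal{A})$, and $\lambda_{\max}$, $\lambda_{\min}$ denote the largest and smallest of them. Powers are T-product powers ($\mathcal{A}^2=\mathcal{A}\star\mathcal{A}$). $\Vert\mathcal{A}\Vert$ is the spectral norm, i.e. the largest singular value of $\mathrm{bcirc}(\mathcal{A})$. *)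

theory Defs
  imports "HOL-Probability.Probability" "Jordan_Normal_Form.Schur_Decomposition"
begin

text \<open>A third-order tensor in C^(m x n x p) is represented as a function
  A i j k = entry (i,j) of the frontal slice k, with 0-based indices
  i < m, j < n, k < p (slice k corresponds to A^(k+1) of the paper).
  Values outside the index ranges are irrelevant.\<close>

type_synonym tensor = "nat \<Rightarrow> nat \<Rightarrow> nat \<Rightarrow> complex"

definition bcirc :: "nat \<Rightarrow> nat \<Rightarrow> nat \<Rightarrow> tensor \<Rightarrow> complex mat" where
  "bcirc m n p A = mat (m * p) (n * p)
     (\<lambda>(a, b). A (a mod m) (b mod n) ((a div m + p - b div n) mod p))"

text \<open>T-product of A (m x n x p) and B (n x q x p): the slices of A * B are
  the slices of the first block column of bcirc A * bcirc B.\<close>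
definition tprod :: "nat \<Rightarrow> nat \<Rightarrow> tensor \<Rightarrow> tensor \<Rightarrow> tensor" where
  "tprod n p A B = (\<lambda>i j k. \<Sum>l<n. \<Sum>t<p. A i l ((k + p - t) mod p) * B l j t)"

definition tconj :: "nat \<Rightarrow> tensor \<Rightarrow> tensor" where
  "tconj p A = (\<lambda>i j k. cnj (A j i ((p - k) mod p)))"

definition hermitian_tensor :: "nat \<Rightarrow> nat \<Rightarrow> tensor \<Rightarrow> bool" where
  "hermitian_tensor m p A \<longleftrightarrow>
     (\<forall>i<m. \<forall>j<m. \<forall>k<p. tconj p A i j k = A i j k)"

text \<open>Largest eigenvalue of a Hermitian T-product tensor (eigenvalues of bcirc A,
  which are real).\<close>
definition tlambda_max :: "nat \<Rightarrow> nat \<Rightarrow> tensor \<Rightarrow> real" where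
  "tlambda_max m p A = Max (Re ` {k. eigenvalue (bcirc m m p A) k})"

definition spec_norm :: "complex mat \<Rightarrow> real" where
  "spec_norm M = sqrt (Max (Re ` {k. eigenvalue (mat_adjoint M * M) k}))"

definition tnorm :: "nat \<Rightarrow> nat \<Rightarrow> nat \<Rightarrow> tensor \<Rightarrow> real" where
  "tnorm m n p A = spec_norm (bcirc m n p A)"

definition std_gaussian_rv :: "'a measure \<Rightarrow> ('a \<Rightarrow> real) \<Rightarrow> bool" where
  "std_gaussian_rv M X \<longleftrightarrow> distributed M lborel X std_normal_density"

definition rademacher_rv :: "'a measure \<Rightarrow> ('a \<Rightarrow> real) \<Rightarrow> bool" where
  "rademacher_rv M X \<longleftrightarrow> X \<in> borel_measurable M \<and>
     measure M {\<omega> \<in> space M. X \<omega> = 1} = 1/2 \<and>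
     measure M {\<omega> \<in> space M. X \<omega> = -1} = 1/2"

end

(*
  Matrix Khintchine inequality by moments. Let X = sum_i a_i B_i and V = sum_i B_i^2, where
  B_i = bcirc A_i. For Hermitian W, Y one has tr (W^a Y^b) = sum_{k,l} P_kl w_k^a y_l^b with
  weights P_kl >= 0, so scalar inequalities for powers transfer to traces. Combined with Gaussian
  integration by parts (or its two-point analogue) in each variable a_i, this gives
    E tr X^(2r+2) <= (2r+1) E tr (V X^(2r)) <= (2r+1) ||V|| E tr X^(2r),
  whence E tr X^(2r) <= mp (2r)! / (2^r r!) ||V||^r, while odd moments vanish by symmetry.
  Markov's inequality is applied to even-degree truncations of exp (which are nonnegative) for the
  largest eigenvalue and of cosh for the norm; letting the degree tend to infinity and choosing the
  exponent theta / ||V|| yields both bounds with the sharp constant and without matrix exponentials.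
*)
theory Submission
  imports Defs "HOL-Computational_Algebra.Fundamental_Theorem_Algebra"
begin

section \<open>Spectral decomposition of Hermitian matrices\<close>

text \<open>The obstacle is noncommutativity: the derivative of tr (A X^(2r+1)) in the direction A
  is the sum over q of tr (A X^q A X^(2r-q)), which in general is not (2r+1) tr (A^2 X^(2r)) but
  only bounded by it. The bound is proved in finite-difference form, for two Hermitian matrices with
  W - Y = c A. This serves both distributions, since a Rademacher variable compares the points 1 and
  -1 and a Gaussian one lets the two points coalesce. It also makes the noncommutativity harmless:
  every word in W and Y that arises becomes some W^a Y^b after a cyclic rotation under the trace.
  The number (2r)! / (2^r r!) is the moment of order 2r of a standard normal variable, so E tr
  X^(2r) is at most mp times that moment of a scalar Gaussian of variance ||V||. The exponential
  series of the scalar moments is exp (u^2 ||V|| / 2), and u = theta / ||V|| minimises u^2 ||V|| / 2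
  - u theta.\<close>

lemma mat_adjoint_carrier [simp]: "A \<in> carrier_mat n m \<Longrightarrow> mat_adjoint A \<in> carrier_mat m n"
  by (auto simp: mat_adjoint_def mat_of_rows_def)

lemma dim_mat_adjoint [simp]:
  "dim_row (mat_adjoint A) = dim_col A" "dim_col (mat_adjoint A) = dim_row A"
  by (auto simp: mat_adjoint_def)

lemma index_mat_adjoint [simp]:
  fixes A :: "complex mat"
  assumes "i < dim_col A" "j < dim_row A"
  shows "mat_adjoint A $$ (i, j) = cnj (A $$ (j, i))"
  using assms by (simp add: mat_adjoint_def mat_of_rows_def)

lemma mat_adjoint_mult:
  fixes A B :: "complex mat"
  assumes "A \<in> carrier_mat n m" "B \<in> carrier_mat m l"
  shows "mat_adjoint (A * B) = mat_adjoint B * mat_adjoint A"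
  using assms by (intro eq_matI) (auto simp: scalar_prod_def mult.commute)

lemma mat_adjoint_adjoint:
  fixes A :: "complex mat"
  shows "mat_adjoint (mat_adjoint A) = A"
  by (intro eq_matI) auto

text \<open>Gram-Schmidt applied to a basis starting with \<open>v\<close> keeps \<open>v\<close> as
  its first vector and gives nonzero orthogonal columns. Dividing each column by its length makes
  them orthonormal, and the first one becomes a multiple of \<open>v\<close>.\<close>

lemma unitary_completion:
  fixes v :: "complex vec"
  assumes v: "v \<in> carrier_vec n" and v0: "v \<noteq> 0\<^sub>v n"
  obtains U c where "U \<in> carrier_mat n n" "mat_adjoint U * U = 1\<^sub>m n" "col U 0 = c \<cdot>\<^sub>v v"
proof -
  interpret cof_vec_space n "TYPE(complex)" .
  have n: "n > 0"
    using v v0 by (cases n) auto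
  define b where "b = basis_completion v"
  define ws where "ws = gram_schmidt n b"
  define W where "W = mat_of_cols n ws"
  note bc = basis_completion[OF v v0, folded b_def]
  obtain vs where bv: "b = v # vs"
    using bc n by (cases b) auto
  have ws: "set ws \<subseteq> carrier_vec n" "corthogonal ws" "length ws = n"
    using gram_schmidt_result[OF _ _ _ refl, of b, folded ws_def] bc by auto
  have hd: "hd ws = v"
    using gram_schmidt_hd[OF v, of vs] bv ws_def by simp
  have W: "W \<in> carrier_mat n n"
    using ws unfolding W_def by (metis mat_of_cols_carrier(1))
  have orth: "corthogonal_mat W"
    using orthogonal_mat_of_cols ws unfolding W_def by blast
  have col0: "col W 0 = v"
    proof -
    have "v = ws ! 0" "0 < length ws" using ws(3) hd n by (auto simp: hd_conv_nth)
    then show ?thesis using v by (simp add: W_def)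
  qed
  define G where "G = (\<lambda>i j. \<Sum>k<n. cnj (W $$ (k, i)) * W $$ (k, j))"
  define q where "q = (\<lambda>j. \<Sum>k<n. (cmod (W $$ (k, j)))\<^sup>2)"
  have Gq: "G j j = of_real (q j)" for j
    unfolding G_def q_def of_real_sum by (intro sum.cong refl) (simp add: complex_norm_square[symmetric] mult.commute del: of_real_power)
  have G0: "G i j = 0 \<longleftrightarrow> i \<noteq> j" if "i < n" "j < n" for i j
  proof -
    have "G i j = col W j \<bullet>c col W i"
      using that W by (auto simp: G_def scalar_prod_def mult.commute atLeast0LessThan intro!: sum.cong)
    then show ?thesis
      using corthogonal_matD[OF orth, of j i] that W by auto
  qed
  have q0: "q j > 0" if "j < n" for j
  proof -
    have "q j \<ge> 0" unfolding q_def by (intro sum_nonneg) auto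
    moreover have "q j \<noteq> 0" using G0[OF that that] Gq[of j] by auto
    ultimately show ?thesis by simp
  qed
  define U where "U = mat n n (\<lambda>(i, j). W $$ (i, j) / of_real (sqrt (q j)))"
  have U: "U \<in> carrier_mat n n" by (simp add: U_def)
  have "mat_adjoint U * U = 1\<^sub>m n"
  proof (rule eq_matI)
    fix i j assume "i < dim_row (1\<^sub>m n :: complex mat)" "j < dim_col (1\<^sub>m n :: complex mat)"
    then have ij: "i < n" "j < n" by auto
    have "(mat_adjoint U * U) $$ (i, j) = G i j / (of_real (sqrt (q i)) * of_real (sqrt (q j)))"
      using ij U
      by (auto simp: scalar_prod_def G_def U_def sum_divide_distrib atLeast0LessThan intro!: sum.cong)
    also have "\<dots> = 1\<^sub>m n $$ (i, j)"
    proof (cases "i = j")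
      case True
      have "G i i = of_real (sqrt (q i)) * of_real (sqrt (q i))"
        using Gq q0[OF ij(1)] by (simp flip: of_real_mult)
      moreover have "complex_of_real (sqrt (q i)) \<noteq> 0"
        using q0[OF ij(1)] by simp
      ultimately show ?thesis using True ij by simp
    next
      case False
      then show ?thesis using G0[OF ij] ij by simp
    qed
    finally show "(mat_adjoint U * U) $$ (i, j) = 1\<^sub>m n $$ (i, j)" .
  qed (use U in auto)
  moreover have "col U 0 = (1 / of_real (sqrt (q 0))) \<cdot>\<^sub>v v"
    using n W col0 v by (auto simp: U_def intro!: eq_vecI) 
  ultimately show thesis using that U by blast
qed

text \<open>The diagonal is a real-valued function, so a decomposition with \<open>diag_real\<close>
  already contains the reality of the eigenvalues of a Hermitian matrix.\<close>

definition diag_real :: "nat \<Rightarrow> (nat \<Rightarrow> real) \<Rightarrow> complex mat" where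
  "diag_real n d = mat n n (\<lambda>(i, j). if i = j then of_real (d i) else 0)"

lemma diag_real_carrier [simp]: "diag_real n d \<in> carrier_mat n n"
  by (simp add: diag_real_def)

lemma unitary_adjoint_right:
  fixes U :: "complex mat"
  assumes "U \<in> carrier_mat n n" "mat_adjoint U * U = 1\<^sub>m n"
  shows "U * mat_adjoint U = 1\<^sub>m n"
  using assms mat_mult_left_right_inverse by (metis mat_adjoint_carrier)

text \<open>Deflation, by induction on the size. A multiple of an eigenvector is the first column of
  a unitary \<open>W\<close>; then the first column of W^H A W vanishes below its corner entry, and
  by symmetry so does the first row to the right of it. The remaining block is Hermitian and smaller
  by one.\<close>

theorem hermitian_mat_diagonalization:
  fixes A :: "complex mat"
  assumes "A \<in> carrier_mat n n" "mat_adjoint A = A"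
  obtains U d where "U \<in> carrier_mat n n" "mat_adjoint U * U = 1\<^sub>m n"
    "A = U * diag_real n d * mat_adjoint U"
  using assms
proof (induction n arbitrary: A thesis)
  case 0
  show ?case
    by (rule 0(1)[of "1\<^sub>m 0" "\<lambda>_. 0"]) (use 0 in \<open>auto intro!: eq_matI simp: diag_real_def\<close>)
next
  case (Suc k)
  let ?n = "Suc k"
  note A = Suc.prems(2) and herm = Suc.prems(3)
  have "degree (char_poly A) > 0"
    using degree_monic_char_poly[OF A] by simp
  then obtain e where "poly (char_poly A) e = 0"
    using fundamental_theorem_of_algebra[of "char_poly A"] by (auto simp: constant_degree)
  then obtain v where v: "v \<in> carrier_vec ?n" "v \<noteq> 0\<^sub>v ?n" "A *\<^sub>v v = e \<cdot>\<^sub>v v"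
    using A unfolding eigenvalue_root_char_poly[OF A, symmetric] eigenvalue_def eigenvector_def by auto
  obtain W c where W: "W \<in> carrier_mat ?n ?n" and WW: "mat_adjoint W * W = 1\<^sub>m ?n"
    and col0: "col W 0 = c \<cdot>\<^sub>v v"
    using unitary_completion[OF v(1,2)] by blast
  define A' where "A' = mat_adjoint W * A * W"
  have W': "mat_adjoint W \<in> carrier_mat ?n ?n" and A': "A' \<in> carrier_mat ?n ?n"
    using W A by (auto simp: A'_def)
  have herm': "cnj (A' $$ (j, i)) = A' $$ (i, j)" if "i < ?n" "j < ?n" for i j
  proof -
    have "mat_adjoint A' = A'"
      unfolding A'_def using A W W' herm
      by (simp add: mat_adjoint_mult[of _ ?n ?n _ ?n] mat_adjoint_adjoint assoc_mult_mat[of _ ?n ?n _ ?n _ ?n])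
    then show ?thesis
      using index_mat_adjoint[of i A' j] A' that by simp
  qed
  have c0: "A' $$ (i, 0) = (if i = 0 then e else 0)" if i: "i < ?n" for i
  proof -
    have "col (A * W) 0 = A *\<^sub>v col W 0"
      using A W by auto
    also have "\<dots> = e \<cdot>\<^sub>v col W 0"
      using v A by (simp add: col0 mult_mat_vec smult_smult_assoc mult.commute)
    finally have *: "col (A * W) 0 = e \<cdot>\<^sub>v col W 0" .
    have "A' = mat_adjoint W * (A * W)"
      using A W W' by (simp add: A'_def assoc_mult_mat[of _ ?n ?n _ ?n _ ?n])
    then have "A' $$ (i, 0) = row (mat_adjoint W) i \<bullet> (e \<cdot>\<^sub>v col W 0)"
      using i A W by (simp add: * )
    also have "\<dots> = e * (mat_adjoint W * W) $$ (i, 0)"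
      using i W W' by simp
    finally show ?thesis using i by (simp add: WW)
  qed
  have er: "e = of_real (Re e)"
    using herm'[of 0 0] c0[of 0] by (metis Reals_cnj_iff complex_is_Real_iff complex_eq_iff Im_complex_of_real Re_complex_of_real zero_less_Suc)
  define A3 where "A3 = mat k k (\<lambda>(i, j). A' $$ (Suc i, Suc j))"
  have A3: "A3 \<in> carrier_mat k k" by (simp add: A3_def)
  have "mat_adjoint A3 = A3"
    using herm' by (auto intro!: eq_matI simp: A3_def)
  from Suc.IH[OF _ A3 this] obtain U d where U: "U \<in> carrier_mat k k"
    "mat_adjoint U * U = 1\<^sub>m k" "A3 = U * diag_real k d * mat_adjoint U" by blast
  \<comment> \<open>\<open>E x X\<close> is block diagonal with blocks \<open>x\<close> and
    \<open>X\<close>. It respects products, adjoints and the identity, which carries the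
    decomposition of \<open>A3\<close> over to \<open>A'\<close>.\<close>
  define E where "E = (\<lambda>x X. four_block_mat (mat 1 1 (\<lambda>_. x)) (0\<^sub>m 1 k) (0\<^sub>m k 1) (X :: complex mat))"
  have E_mult: "E x X * E y Y = E (x * y) (X * Y)"
    if "X \<in> carrier_mat k k" "Y \<in> carrier_mat k k" for x y X Y
    unfolding E_def using that
    by (subst mult_four_block_mat[of _ 1 1 _ k _ k _ _ 1 _ k])
       (auto intro!: arg_cong[where f = "\<lambda>Z. four_block_mat Z _ _ _"] eq_matI simp: scalar_prod_def)
  have E_adj: "mat_adjoint (E x X) = E (cnj x) (mat_adjoint X)" if "X \<in> carrier_mat k k" for x X
    unfolding E_def using that by (intro eq_matI) auto
  have E_one: "E 1 (1\<^sub>m k) = 1\<^sub>m ?n"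
    unfolding E_def by (intro eq_matI) auto
  have E_carrier: "E x X \<in> carrier_mat ?n ?n" if "X \<in> carrier_mat k k" for x X
    unfolding E_def carrier_mat_def using that by auto
  define d' where "d' = case_nat (Re e) d"
  have E_diag: "E e (diag_real k d) = diag_real ?n d'"
    unfolding E_def diag_real_def d'_def using er by (intro eq_matI) (auto split: nat.splits)
  have "A' = E e A3"
  proof (rule eq_matI)
    fix i j assume "i < dim_row (E e A3)" "j < dim_col (E e A3)"
    then have ij: "i < ?n" "j < ?n" using E_carrier[OF A3, of e] by auto
    show "A' $$ (i, j) = E e A3 $$ (i, j)"
    proof (cases "j = 0")
      case True
      then show ?thesis using c0[OF ij(1)] ij A3 by (auto simp: E_def)
    next
      case j: False
      show ?thesis
      proof (cases "i = 0")
        case True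
        then show ?thesis using c0[OF ij(2)] herm'[OF ij] j ij A3 by (auto simp: E_def)
      next
        case False
        then show ?thesis using j ij by (auto simp: E_def A3_def)
      qed
    qed
  qed (use A' E_carrier[OF A3, of e] in auto)
  also have "\<dots> = E 1 U * diag_real ?n d' * E 1 (mat_adjoint U)"
    using U by (simp add: E_mult flip: E_diag)
  finally have A'_eq: "A' = E 1 U * diag_real ?n d' * mat_adjoint (E 1 U)"
    using U by (simp add: E_adj)
  define V where "V = W * E 1 U"
  note EU = E_carrier[OF U(1), of 1]
  have V: "V \<in> carrier_mat ?n ?n" using W EU by (simp add: V_def)
  have V_adj: "mat_adjoint V = mat_adjoint (E 1 U) * mat_adjoint W"
    unfolding V_def using W EU by (simp add: mat_adjoint_mult[of _ ?n ?n _ ?n])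
  have EU': "mat_adjoint (E 1 U) \<in> carrier_mat ?n ?n" using EU by simp
  have "mat_adjoint W * (W * E 1 U) = E 1 U"
    using EU by (simp add: WW flip: assoc_mult_mat[OF W' W EU])
  then have "mat_adjoint V * V = mat_adjoint (E 1 U) * E 1 U"
    unfolding V_adj unfolding V_def using W W' EU EU'
    by (simp add: assoc_mult_mat[of _ ?n ?n _ ?n _ ?n])
  also have "\<dots> = 1\<^sub>m ?n"
    using U by (simp add: E_adj E_mult E_one)
  finally have 1: "mat_adjoint V * V = 1\<^sub>m ?n" .
  have WW': "W * mat_adjoint W = 1\<^sub>m ?n"
    by (rule unitary_adjoint_right[OF W WW])
  have "W * A' = (W * mat_adjoint W) * (A * W)"
    unfolding A'_def using W W' A by (simp add: assoc_mult_mat[of _ ?n ?n _ ?n _ ?n])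
  then have "W * A' * mat_adjoint W = A * (W * mat_adjoint W)"
    using W W' A by (simp add: WW' assoc_mult_mat[of _ ?n ?n _ ?n _ ?n] left_mult_one_mat[of _ ?n ?n])
  then have "A = W * A' * mat_adjoint W"
    using A by (simp add: WW')
  also have "\<dots> = V * diag_real ?n d' * mat_adjoint V"
  proof -
    define D where "D = diag_real ?n d'"
    define F where "F = mat_adjoint (E 1 U)"
    have [simp]: "D \<in> carrier_mat ?n ?n" "F \<in> carrier_mat ?n ?n"
      using EU by (auto simp: D_def F_def)
    show ?thesis
      unfolding V_adj A'_eq unfolding V_def D_def[symmetric] F_def[symmetric] using W W' EU
      by (simp add: assoc_mult_mat[of _ ?n ?n _ ?n _ ?n] mult_carrier_mat[of _ ?n ?n _ ?n])
  qed
  finally show ?case using Suc.prems(1)[OF V 1] by blast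
qed

section \<open>Traces and spectra of powers of Hermitian matrices\<close>

definition mat_trace :: "complex mat \<Rightarrow> complex" where
  "mat_trace A = (\<Sum>i<dim_row A. A $$ (i, i))"

lemma mat_trace_mult:
  assumes "A \<in> carrier_mat n m" "B \<in> carrier_mat m n"
  shows "mat_trace (A * B) = (\<Sum>i<n. \<Sum>j<m. A $$ (i, j) * B $$ (j, i))"
  using assms by (auto simp: mat_trace_def scalar_prod_def atLeast0LessThan)

lemma mat_trace_mult_commute:
  assumes "A \<in> carrier_mat n m" "B \<in> carrier_mat m n"
  shows "mat_trace (A * B) = mat_trace (B * A)"
  unfolding mat_trace_mult[OF assms] mat_trace_mult[OF assms(2,1)] by (subst sum.swap) (simp add: mult.commute)

lemma diag_real_pow: "diag_real n d ^\<^sub>m a = diag_real n (\<lambda>k. d k ^ a)"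
proof (induction a)
  case 0
  show ?case by (intro eq_matI) (auto simp: diag_real_def)
next
  case (Suc a)
  show ?case
    unfolding pow_mat.simps Suc
    by (intro eq_matI) (auto simp: diag_real_def scalar_prod_def if_distrib[of "\<lambda>x. x * _"] if_distrib[of "\<lambda>x. _ * x"] cong: if_cong)
qed

lemma eigenvalues_diag_real: "{e. eigenvalue (diag_real n d) e} = (\<lambda>k. of_real (d k)) ` {..<n}"
proof -
  have "upper_triangular (diag_real n d)"
    by (auto simp: diag_real_def upper_triangular_def)
  then have "char_poly (diag_real n d) = (\<Prod>a\<leftarrow>diag_mat (diag_real n d). [:- a, 1:])"
    using char_poly_upper_triangular[OF diag_real_carrier] by blast
  moreover have "set (diag_mat (diag_real n d)) = (\<lambda>k. of_real (d k)) ` {..<n}"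
    by (auto simp: diag_mat_def diag_real_def)
  ultimately show ?thesis
    by (auto simp: eigenvalue_root_char_poly[OF diag_real_carrier] poly_prod_list prod_list_zero_iff)
qed

text \<open>One pair \<open>U\<close>, \<open>d\<close> serves all exponents, because a similarity
  of \<open>A\<close> with a diagonal matrix is also a similarity of their powers. Entries are
  written as sums so that traces of products become multiple sums.\<close>

lemma hermitian_mat_pow_spectral:
  fixes A :: "complex mat"
  assumes A: "A \<in> carrier_mat n n" and "mat_adjoint A = A"
  obtains U d where
    "\<And>k l. k < n \<Longrightarrow> l < n \<Longrightarrow> (\<Sum>i<n. cnj (U i k) * U i l) = (if k = l then 1 else 0)"
    "\<And>a i j. i < n \<Longrightarrow> j < n \<Longrightarrow>
        (A ^\<^sub>m a) $$ (i, j) = (\<Sum>k<n. U i k * of_real (d k ^ a) * cnj (U j k))"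
    "\<And>a. {e. eigenvalue (A ^\<^sub>m a) e} = (\<lambda>k. of_real (d k ^ a)) ` {..<n}"
proof -
  obtain U d where U: "U \<in> carrier_mat n n" "mat_adjoint U * U = 1\<^sub>m n"
    "A = U * diag_real n d * mat_adjoint U"
    using hermitian_mat_diagonalization[OF assms] by blast
  have "similar_mat_wit A (diag_real n d) U (mat_adjoint U)"
    using U A unitary_adjoint_right[OF U(1,2)] by (intro similar_mat_witI[of _ _ n]) auto
  from similar_mat_wit_pow[OF this]
  have sim: "similar_mat_wit (A ^\<^sub>m a) (diag_real n (\<lambda>k. d k ^ a)) U (mat_adjoint U)" for a
    by (simp add: diag_real_pow)
  show thesis
  proof
    fix k l assume "k < n" "l < n"
    then show "(\<Sum>i<n. cnj (U $$ (i, k)) * U $$ (i, l)) = (if k = l then 1 else 0)"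
      using arg_cong[OF U(2), of "\<lambda>M. M $$ (k, l)"] U(1)
      by (simp add: scalar_prod_def atLeast0LessThan)
  next
    fix a i j assume ij: "i < n" "j < n"
    have "A ^\<^sub>m a = U * diag_real n (\<lambda>k. d k ^ a) * mat_adjoint U"
      using sim[of a] unfolding similar_mat_wit_def Let_def by blast
    also have "U * diag_real n (\<lambda>k. d k ^ a) = mat n n (\<lambda>(i, k). U $$ (i, k) * of_real (d k ^ a))"
      using U(1) by (intro eq_matI) (auto simp: diag_real_def scalar_prod_def if_distrib[of "\<lambda>x. x * _"] if_distrib[of "\<lambda>x. _ * x"] cong: if_cong)
    finally show "(A ^\<^sub>m a) $$ (i, j) = (\<Sum>k<n. U $$ (i, k) * of_real (d k ^ a) * cnj (U $$ (j, k)))"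
      using ij U(1) by (simp add: scalar_prod_def atLeast0LessThan)
  next
    fix a
    have "char_poly (A ^\<^sub>m a) = char_poly (diag_real n (\<lambda>k. d k ^ a))"
      using sim[of a] by (intro char_poly_similar) (auto simp: similar_mat_def)
    then show "{e. eigenvalue (A ^\<^sub>m a) e} = (\<lambda>k. of_real (d k ^ a)) ` {..<n}"
      unfolding eigenvalues_diag_real[symmetric] eigenvalue_root_char_poly[OF pow_carrier_mat[OF A]]
        eigenvalue_root_char_poly[OF diag_real_carrier] by simp
  qed
qed

text \<open>\<open>P k l\<close> is the squared absolute value of the inner product of the k-th
  eigenvector of \<open>W\<close> with the l-th eigenvector of \<open>Y\<close>. It is the same for
  all exponents, so a polynomial inequality that holds at all pairs (\<nu> k, \<mu> l) can be summed
  with these weights to give an inequality of traces.\<close>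

lemma hermitian_pair_traces:
  fixes W Y :: "complex mat"
  assumes W: "W \<in> carrier_mat n n" "mat_adjoint W = W"
    and Y: "Y \<in> carrier_mat n n" "mat_adjoint Y = Y"
  obtains P and \<nu> \<mu> :: "nat \<Rightarrow> real" where
    "\<And>k l. P k l \<ge> 0"
    "\<And>a b. mat_trace (W ^\<^sub>m a * Y ^\<^sub>m b) = of_real (\<Sum>k<n. \<Sum>l<n. P k l * (\<nu> k ^ a * \<mu> l ^ b))"
    "\<And>a. {e. eigenvalue (W ^\<^sub>m a) e} = (\<lambda>k. of_real (\<nu> k ^ a)) ` {..<n}"
    "\<And>a. {e. eigenvalue (Y ^\<^sub>m a) e} = (\<lambda>k. of_real (\<mu> k ^ a)) ` {..<n}"
proof -
  obtain U \<nu> where U: "\<And>k l. k < n \<Longrightarrow> l < n \<Longrightarrow> (\<Sum>i<n. cnj (U i k) * U i l) = (if k = l then 1 else 0)"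
    "\<And>a i j. i < n \<Longrightarrow> j < n \<Longrightarrow>
        (W ^\<^sub>m a) $$ (i, j) = (\<Sum>k<n. U i k * of_real (\<nu> k ^ a) * cnj (U j k))"
    "\<And>a. {e. eigenvalue (W ^\<^sub>m a) e} = (\<lambda>k. of_real (\<nu> k ^ a)) ` {..<n}"
    using hermitian_mat_pow_spectral[OF W] by blast
  obtain V \<mu> where V: "\<And>k l. k < n \<Longrightarrow> l < n \<Longrightarrow> (\<Sum>i<n. cnj (V i k) * V i l) = (if k = l then 1 else 0)"
    "\<And>a i j. i < n \<Longrightarrow> j < n \<Longrightarrow>
        (Y ^\<^sub>m a) $$ (i, j) = (\<Sum>k<n. V i k * of_real (\<mu> k ^ a) * cnj (V j k))"
    "\<And>a. {e. eigenvalue (Y ^\<^sub>m a) e} = (\<lambda>k. of_real (\<mu> k ^ a)) ` {..<n}"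
    using hermitian_mat_pow_spectral[OF Y] by blast
  define G where "G = (\<lambda>k l. \<Sum>j<n. cnj (U j k) * V j l)"
  show thesis
  proof
    show "0 \<le> (cmod (G k l))\<^sup>2" for k l by simp
    fix a b
    have "mat_trace (W ^\<^sub>m a * Y ^\<^sub>m b) = (\<Sum>i<n. \<Sum>j<n. \<Sum>k<n. \<Sum>l<n.
        (of_real (\<nu> k ^ a) * of_real (\<mu> l ^ b)) * (U i k * cnj (V i l) * (cnj (U j k) * V j l)))"
      using W(1) Y(1)
      by (simp add: mat_trace_mult[of _ n n] U(2) V(2) sum_product mult_ac)
    \<comment> \<open>Once the sums over the matrix indices \<open>i\<close> and \<open>j\<close>
      are innermost, they factor into \<open>G k l\<close> and its conjugate.\<close>
    also have "\<dots> = (\<Sum>k<n. \<Sum>l<n. \<Sum>i<n. \<Sum>j<n.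
        (of_real (\<nu> k ^ a) * of_real (\<mu> l ^ b)) * (U i k * cnj (V i l) * (cnj (U j k) * V j l)))"
    proof -
      have "(\<Sum>i<n. \<Sum>j<n. \<Sum>k<n. \<Sum>l<n. F i j k l) = (\<Sum>k<n. \<Sum>l<n. \<Sum>i<n. \<Sum>j<n. F i j k l)" for F :: "nat \<Rightarrow> nat \<Rightarrow> nat \<Rightarrow> nat \<Rightarrow> complex"
      proof -
        have "(\<Sum>i<n. \<Sum>j<n. \<Sum>k<n. \<Sum>l<n. F i j k l) = (\<Sum>i<n. \<Sum>k<n. \<Sum>j<n. \<Sum>l<n. F i j k l)"
          by (intro sum.cong refl sum.swap)
        also have "\<dots> = (\<Sum>k<n. \<Sum>i<n. \<Sum>j<n. \<Sum>l<n. F i j k l)"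
          by (rule sum.swap)
        also have "\<dots> = (\<Sum>k<n. \<Sum>i<n. \<Sum>l<n. \<Sum>j<n. F i j k l)"
          by (intro sum.cong refl sum.swap)
        also have "\<dots> = (\<Sum>k<n. \<Sum>l<n. \<Sum>i<n. \<Sum>j<n. F i j k l)"
          by (intro sum.cong refl sum.swap)
        finally show ?thesis .
      qed
      then show ?thesis .
    qed
    also have "\<dots> = (\<Sum>k<n. \<Sum>l<n. of_real (\<nu> k ^ a) * of_real (\<mu> l ^ b) * (cnj (G k l) * G k l))"
      unfolding G_def cnj_sum sum_product complex_cnj_mult complex_cnj_cnj
      by (simp add: sum_distrib_left)
    also have "\<dots> = of_real (\<Sum>k<n. \<Sum>l<n. (cmod (G k l))\<^sup>2 * (\<nu> k ^ a * \<mu> l ^ b))"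
      unfolding of_real_sum
      by (intro sum.cong refl)
         (metis complex_norm_square mult.commute of_real_mult)
    finally show "mat_trace (W ^\<^sub>m a * Y ^\<^sub>m b) = of_real (\<Sum>k<n. \<Sum>l<n. (cmod (G k l))\<^sup>2 * (\<nu> k ^ a * \<mu> l ^ b))" .
  qed (use U V in blast)+
qed

lemma hermitian_mat_pow_trace:
  fixes A :: "complex mat"
  assumes A: "A \<in> carrier_mat n n" "mat_adjoint A = A"
  obtains \<nu> :: "nat \<Rightarrow> real" where
    "\<And>a. mat_trace (A ^\<^sub>m a) = of_real (\<Sum>k<n. \<nu> k ^ a)"
    "\<And>a. {e. eigenvalue (A ^\<^sub>m a) e} = (\<lambda>k. of_real (\<nu> k ^ a)) ` {..<n}"
proof -
  obtain U \<nu> where U: "\<And>k l. k < n \<Longrightarrow> l < n \<Longrightarrow> (\<Sum>i<n. cnj (U i k) * U i l) = (if k = l then 1 else 0)"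
    "\<And>a i j. i < n \<Longrightarrow> j < n \<Longrightarrow>
        (A ^\<^sub>m a) $$ (i, j) = (\<Sum>k<n. U i k * of_real (\<nu> k ^ a) * cnj (U j k))"
    "\<And>a. {e. eigenvalue (A ^\<^sub>m a) e} = (\<lambda>k. of_real (\<nu> k ^ a)) ` {..<n}"
    using hermitian_mat_pow_spectral[OF A] by blast
  have "mat_trace (A ^\<^sub>m a) = of_real (\<Sum>k<n. \<nu> k ^ a)" for a
  proof -
    have "mat_trace (A ^\<^sub>m a) = (\<Sum>i<n. \<Sum>k<n. of_real (\<nu> k ^ a) * (cnj (U i k) * U i k))"
      using A(1) by (simp add: mat_trace_def U(2) mult_ac)
    also have "\<dots> = (\<Sum>k<n. of_real (\<nu> k ^ a) * (\<Sum>i<n. cnj (U i k) * U i k))"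
      by (subst sum.swap) (simp add: sum_distrib_left)
    finally show ?thesis by (simp add: U(1))
  qed
  with U(3) that show thesis by blast
qed

section \<open>Trace inequalities\<close>

lemma mult_pow_mat_left:
  assumes "A \<in> carrier_mat n n"
  shows "A * A ^\<^sub>m k = A ^\<^sub>m Suc k"
proof (induction k)
  case (Suc k)
  have "A * A ^\<^sub>m Suc k = (A * A ^\<^sub>m k) * A"
    using assms by (simp add: assoc_mult_mat[of _ n n _ n _ n])
  then show ?case by (simp add: Suc)
qed (use assms in auto)

text \<open>The terms for q and s = 2r - q are paired: |x|^q - |y|^q and |x|^s - |y|^s have the same
  sign, so x^q y^s + x^s y^q is at most x^(2r) + y^(2r). The constant is the number of terms, 2r +
  1, halved for the pairing.\<close>

lemma sum_mixed_powers_le: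
  fixes x y :: real
  shows "(\<Sum>q\<le>2 * r. x ^ q * y ^ (2 * r - q)) \<le> (2 * real r + 1) / 2 * (x ^ (2 * r) + y ^ (2 * r))"
proof -
  have le: "x ^ q * y ^ s + x ^ s * y ^ q \<le> x ^ (2 * r) + y ^ (2 * r)" if "q + s = 2 * r" for q s
  proof -
    have "(\<bar>x\<bar> ^ q - \<bar>y\<bar> ^ q) * (\<bar>x\<bar> ^ s - \<bar>y\<bar> ^ s) \<ge> 0"
      by (cases rule: linorder_le_cases[of "\<bar>x\<bar>" "\<bar>y\<bar>"])
         (auto intro: mult_nonneg_nonneg mult_nonpos_nonpos simp: power_mono)
    then have "\<bar>x\<bar> ^ q * \<bar>y\<bar> ^ s + \<bar>x\<bar> ^ s * \<bar>y\<bar> ^ q \<le> \<bar>x\<bar> ^ (q + s) + \<bar>y\<bar> ^ (q + s)"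
      by (simp add: algebra_simps power_add)
    moreover have "x ^ q * y ^ s + x ^ s * y ^ q \<le> \<bar>x\<bar> ^ q * \<bar>y\<bar> ^ s + \<bar>x\<bar> ^ s * \<bar>y\<bar> ^ q"
      by (intro add_mono) (metis abs_ge_self abs_mult power_abs)+
    ultimately show ?thesis by (simp add: that power_even_abs)
  qed
  have "(\<Sum>q\<le>2 * r. x ^ q * y ^ (2 * r - q)) = (\<Sum>q\<le>2 * r. x ^ (2 * r - q) * y ^ q)"
    by (rule sum.reindex_bij_witness[of _ "\<lambda>q. 2 * r - q" "\<lambda>q. 2 * r - q"]) auto
  then have "2 * (\<Sum>q\<le>2 * r. x ^ q * y ^ (2 * r - q)) =
      (\<Sum>q\<le>2 * r. x ^ q * y ^ (2 * r - q) + x ^ (2 * r - q) * y ^ q)"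
    by (simp add: sum.distrib)
  also have "\<dots> \<le> (\<Sum>q\<le>2 * r. x ^ (2 * r) + y ^ (2 * r))"
    by (intro sum_mono le) auto
  also have "\<dots> = (2 * real r + 1) * (x ^ (2 * r) + y ^ (2 * r))" by simp
  finally show ?thesis by simp
qed

text \<open>The left side is (x - y)^2 times the sum of mixed powers. Multiplying by
  \<open>x - y\<close> instead of dividing keeps the estimate valid for either sign of
  \<open>x - y\<close>; this is the shape that \<open>stein_law\<close> asks for.\<close>

lemma odd_power_diff_le:
  fixes x y :: real
  shows "(x - y) * (x ^ (2 * r + 1) - y ^ (2 * r + 1)) \<le>
    (2 * real r + 1) / 2 * ((x - y)\<^sup>2 * (x ^ (2 * r) + y ^ (2 * r)))"
proof -
  have "(x - y) * (x ^ (2 * r + 1) - y ^ (2 * r + 1)) =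
      (x - y)\<^sup>2 * (\<Sum>q\<le>2 * r. x ^ q * y ^ (2 * r - q))"
    using diff_power_eq_sum[of x "2 * r" y]
    by (simp add: power2_eq_square lessThan_Suc_atMost)
  also have "\<dots> \<le> (x - y)\<^sup>2 * ((2 * real r + 1) / 2 * (x ^ (2 * r) + y ^ (2 * r)))"
    by (intro mult_left_mono sum_mixed_powers_le) auto
  finally show ?thesis by (simp add: mult_ac)
qed

text \<open>A discrete bound on the derivative of tr (A X^(2r+1)): in the application
  \<open>W\<close> and \<open>Y\<close> are the series with one coefficient set to x and to y, and c
  = x - y. Replacing each \<open>c A\<close> by \<open>W - Y\<close> leaves only traces of W^a Y^b,
  and \<open>odd_power_diff_le\<close> is then applied at every pair of eigenvalues.\<close>

lemma trace_mean_value_inequality: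
  fixes A W Y :: "complex mat" and c :: real
  assumes A: "A \<in> carrier_mat n n"
    and W: "W \<in> carrier_mat n n" "mat_adjoint W = W"
    and Y: "Y \<in> carrier_mat n n" "mat_adjoint Y = Y"
    and WY: "\<And>i j. i < n \<Longrightarrow> j < n \<Longrightarrow> W $$ (i, j) - Y $$ (i, j) = of_real c * A $$ (i, j)"
  shows "c * (Re (mat_trace (A * W ^\<^sub>m (2 * r + 1))) - Re (mat_trace (A * Y ^\<^sub>m (2 * r + 1)))) \<le>
    c\<^sup>2 * ((2 * real r + 1) / 2 * Re (mat_trace (A * A * W ^\<^sub>m (2 * r))) +
          (2 * real r + 1) / 2 * Re (mat_trace (A * A * Y ^\<^sub>m (2 * r))))"
proof -
  obtain P \<nu> \<mu> where P: "\<And>k l. P k l \<ge> (0::real)"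
    and tr: "\<And>a b. mat_trace (W ^\<^sub>m a * Y ^\<^sub>m b) = of_real (\<Sum>k<n. \<Sum>l<n. P k l * (\<nu> k ^ a * \<mu> l ^ b))"
    by (rule hermitian_pair_traces[OF W Y]) blast
  define \<tau> where "\<tau> a b = Re (mat_trace (W ^\<^sub>m a * Y ^\<^sub>m b))" for a b
  have \<tau>: "\<tau> a b = (\<Sum>k<n. \<Sum>l<n. P k l * (\<nu> k ^ a * \<mu> l ^ b))" for a b
    by (simp add: \<tau>_def tr)
  note carr [simp] = A W(1) Y(1) pow_carrier_mat[OF W(1)] pow_carrier_mat[OF Y(1)] mult_carrier_mat[of _ n n _ n]
    left_mult_one_mat[of _ n n] right_mult_one_mat[of _ n n]
  note assoc = assoc_mult_mat[of _ n n _ n _ n]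
  have diff: "c * Re (mat_trace (A * M)) = Re (mat_trace (W * M)) - Re (mat_trace (Y * M))" if M [simp]: "M \<in> carrier_mat n n" for M
  proof -
    have "of_real c * mat_trace (A * M) = (\<Sum>i<n. \<Sum>j<n. (of_real c * A $$ (i, j)) * M $$ (j, i))"
      by (simp add: mat_trace_mult[of _ n n] sum_distrib_left mult.assoc)
    also have "\<dots> = (\<Sum>i<n. \<Sum>j<n. (W $$ (i, j) - Y $$ (i, j)) * M $$ (j, i))"
      by (intro sum.cong refl) (simp add: WY)
    also have "\<dots> = mat_trace (W * M) - mat_trace (Y * M)"
      by (simp add: mat_trace_mult[of _ n n] left_diff_distrib sum_subtractf)
    finally have "of_real c * mat_trace (A * M) = mat_trace (W * M) - mat_trace (Y * M)" .
    from arg_cong[OF this, of Re] show ?thesis by simp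
  qed
  have cyc: "mat_trace (M * N) = mat_trace (N * M)" if "M \<in> carrier_mat n n" "N \<in> carrier_mat n n" for M N
    using mat_trace_mult_commute that by blast
  have diff2: "c\<^sup>2 * Re (mat_trace (A * A * M)) = Re (mat_trace (W * (M * W))) - Re (mat_trace (Y * (M * W)))
      - (Re (mat_trace (W * (M * Y))) - Re (mat_trace (Y * (M * Y))))"
    if M [simp]: "M \<in> carrier_mat n n" for M
  proof -
    have *: "mat_trace (N * (A * M)) = mat_trace (A * (M * N))" if [simp]: "N \<in> carrier_mat n n" for N
      by (simp add: cyc[of N] assoc)
    have "c\<^sup>2 * Re (mat_trace (A * A * M)) = c * (c * Re (mat_trace (A * (A * M))))"
      by (simp add: assoc power2_eq_square)
    also have "\<dots> = c * Re (mat_trace (A * (M * W))) - c * Re (mat_trace (A * (M * Y)))"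
      using diff[of "A * M"] *[of W] *[of Y] by (simp add: right_diff_distrib)
    finally show ?thesis by (simp add: diff)
  qed
  have pw: "W * W ^\<^sub>m k = W ^\<^sub>m Suc k" "Y * Y ^\<^sub>m k = Y ^\<^sub>m Suc k" for k
    using mult_pow_mat_left W(1) Y(1) by blast+
  have one: "W ^\<^sub>m 0 = 1\<^sub>m n" "Y ^\<^sub>m 0 = 1\<^sub>m n" "W ^\<^sub>m 1 = W" "Y ^\<^sub>m 1 = Y"
    "W ^\<^sub>m 2 = W * W" "Y ^\<^sub>m 2 = Y * Y"
    by (auto simp: numeral_2_eq_2 carrier_matD[OF W(1)] carrier_matD[OF Y(1)])
  have WWk: "Re (mat_trace (W * W ^\<^sub>m k)) = \<tau> (Suc k) 0" for k
    unfolding \<tau>_def one by (simp add: pw del: pow_mat.simps)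
  have YWk: "Re (mat_trace (Y * W ^\<^sub>m k)) = \<tau> k 1" for k
    unfolding \<tau>_def one by (simp add: cyc[of Y])
  have WYk: "Re (mat_trace (W * Y ^\<^sub>m k)) = \<tau> 1 k" for k
    unfolding \<tau>_def one by simp
  have YYk: "Re (mat_trace (Y * Y ^\<^sub>m k)) = \<tau> 0 (Suc k)" for k
    unfolding \<tau>_def one by (simp add: pw del: pow_mat.simps)
  define k where "k = 2 * r + 1"
  define s where "s = 2 * r"
  have L: "c * (Re (mat_trace (A * W ^\<^sub>m k)) - Re (mat_trace (A * Y ^\<^sub>m k))) =
      \<tau> (Suc k) 0 - \<tau> k 1 - \<tau> 1 k + \<tau> 0 (Suc k)"
    by (simp add: right_diff_distrib diff WWk YWk WYk YYk)
  \<comment> \<open>Cyclicity collects the factors \<open>W\<close> in front of the factors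
    \<open>Y\<close>. The three terms are the weighted form of (\<nu> - \<mu>)^2 \<nu>^s, as those
    of \<open>R2\<close> are of (\<nu> - \<mu>)^2 \<mu>^s.\<close>
  have R1: "c\<^sup>2 * Re (mat_trace (A * A * W ^\<^sub>m s)) = \<tau> (Suc (Suc s)) 0 - 2 * \<tau> (Suc s) 1 + \<tau> s 2"
  proof -
    have "W * (W ^\<^sub>m s * Y) = W ^\<^sub>m Suc s * Y"
      by (simp add: pw del: pow_mat.simps flip: assoc)
    then have 1: "Re (mat_trace (W * (W ^\<^sub>m s * Y))) = \<tau> (Suc s) 1"
      unfolding \<tau>_def one by simp
    have 2: "Re (mat_trace (Y * (W ^\<^sub>m s * Y))) = \<tau> s 2"
      unfolding \<tau>_def one by (simp add: cyc[of Y] assoc)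
    have "W ^\<^sub>m s * W = W ^\<^sub>m Suc s" by simp
    then show ?thesis
      by (simp add: diff2 1 2 WWk YWk del: pow_mat.simps)
  qed
  have R2: "c\<^sup>2 * Re (mat_trace (A * A * Y ^\<^sub>m s)) = \<tau> 2 s - 2 * \<tau> 1 (Suc s) + \<tau> 0 (Suc (Suc s))"
  proof -
    have "mat_trace (Y * (Y ^\<^sub>m s * W)) = mat_trace (Y ^\<^sub>m Suc s * W)"
      by (simp add: pw del: pow_mat.simps flip: assoc)
    also have "\<dots> = mat_trace (W * Y ^\<^sub>m Suc s)"
      by (simp add: cyc[of W] del: pow_mat.simps)
    finally have 1: "Re (mat_trace (Y * (Y ^\<^sub>m s * W))) = \<tau> 1 (Suc s)"
      unfolding \<tau>_def one by simp
    have "mat_trace (W * (Y ^\<^sub>m s * W)) = mat_trace (W * W * Y ^\<^sub>m s)"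
      by (simp add: assoc cyc[of W "Y ^\<^sub>m s * W"] cyc[of "Y ^\<^sub>m s" "W * W"])
    then have 2: "Re (mat_trace (W * (Y ^\<^sub>m s * W))) = \<tau> 2 s"
      unfolding \<tau>_def one by simp
    have "Y ^\<^sub>m s * Y = Y ^\<^sub>m Suc s" by simp
    then show ?thesis
      by (simp add: diff2 1 2 WYk YYk del: pow_mat.simps)
  qed
  have "c * (Re (mat_trace (A * W ^\<^sub>m k)) - Re (mat_trace (A * Y ^\<^sub>m k))) =
      (\<Sum>i<n. \<Sum>j<n. P i j * ((\<nu> i - \<mu> j) * (\<nu> i ^ k - \<mu> j ^ k)))"
    unfolding L \<tau> by (simp add: algebra_simps sum.distrib sum_subtractf)
  also have "\<dots> \<le> (\<Sum>i<n. \<Sum>j<n. P i j * ((2 * real r + 1) / 2 * ((\<nu> i - \<mu> j)\<^sup>2 * (\<nu> i ^ s + \<mu> j ^ s))))"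
    unfolding k_def s_def by (intro sum_mono mult_left_mono odd_power_diff_le P)
  also have "\<dots> = (2 * real r + 1) / 2 *
      (\<Sum>i<n. \<Sum>j<n. P i j * ((\<nu> i - \<mu> j)\<^sup>2 * (\<nu> i ^ s + \<mu> j ^ s)))"
    by (simp add: sum_distrib_left mult_ac)
  also have "(\<Sum>i<n. \<Sum>j<n. P i j * ((\<nu> i - \<mu> j)\<^sup>2 * (\<nu> i ^ s + \<mu> j ^ s))) =
      c\<^sup>2 * Re (mat_trace (A * A * W ^\<^sub>m s)) + c\<^sup>2 * Re (mat_trace (A * A * Y ^\<^sub>m s))"
    unfolding R1 R2 \<tau>
    by (simp add: sum_distrib_left power2_eq_square algebra_simps flip: sum.distrib sum_subtractf)
  finally show ?thesis
    unfolding k_def s_def by (simp add: distrib_left mult_ac)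
qed

text \<open>Because the power is even, the factors \<mu>_l^(2r) in the weighted sum are nonnegative,
  so each eigenvalue of \<open>V\<close> may be replaced by its upper bound
  \<open>s\<close>.\<close>

lemma trace_mult_even_power_le:
  fixes V X :: "complex mat"
  assumes V: "V \<in> carrier_mat n n" "mat_adjoint V = V"
    and X: "X \<in> carrier_mat n n" "mat_adjoint X = X"
    and le: "\<And>e. eigenvalue V e \<Longrightarrow> Re e \<le> s"
  shows "Re (mat_trace (V * X ^\<^sub>m (2 * r))) \<le> s * Re (mat_trace (X ^\<^sub>m (2 * r)))"
proof -
  obtain P \<nu> \<mu> where P: "\<And>k l. P k l \<ge> (0::real)"
    and tr: "\<And>a b. mat_trace (V ^\<^sub>m a * X ^\<^sub>m b) = of_real (\<Sum>k<n. \<Sum>l<n. P k l * (\<nu> k ^ a * \<mu> l ^ b))"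
    and ev: "\<And>a. {e. eigenvalue (V ^\<^sub>m a) e} = (\<lambda>k. of_real (\<nu> k ^ a)) ` {..<n}"
    by (rule hermitian_pair_traces[OF V X]) blast
  have pw: "V ^\<^sub>m 1 = V" "V ^\<^sub>m 0 = 1\<^sub>m n" using V by auto
  have "\<nu> k \<le> s" if "k < n" for k
    using le[of "of_real (\<nu> k)"] ev[of 1] that unfolding pw by auto
  then have "(\<Sum>k<n. \<Sum>l<n. P k l * (\<nu> k ^ 1 * \<mu> l ^ (2 * r))) \<le> (\<Sum>k<n. \<Sum>l<n. P k l * (s * \<mu> l ^ (2 * r)))"
    by (intro sum_mono mult_left_mono mult_right_mono P) auto
  also have "\<dots> = s * (\<Sum>k<n. \<Sum>l<n. P k l * (\<nu> k ^ 0 * \<mu> l ^ (2 * r)))"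
    by (simp add: sum_distrib_left mult_ac)
  finally have "(\<Sum>k<n. \<Sum>l<n. P k l * (\<nu> k ^ 1 * \<mu> l ^ (2 * r)))
      \<le> s * (\<Sum>k<n. \<Sum>l<n. P k l * (\<nu> k ^ 0 * \<mu> l ^ (2 * r)))" .
  moreover have "Re (mat_trace (V * X ^\<^sub>m (2 * r))) = (\<Sum>k<n. \<Sum>l<n. P k l * (\<nu> k ^ 1 * \<mu> l ^ (2 * r)))"
    using arg_cong[OF tr[of 1 "2 * r"], of Re] unfolding pw Re_complex_of_real .
  moreover have "Re (mat_trace (X ^\<^sub>m (2 * r))) = (\<Sum>k<n. \<Sum>l<n. P k l * (\<nu> k ^ 0 * \<mu> l ^ (2 * r)))"
    using arg_cong[OF tr[of 0 "2 * r"], of Re] X(1)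
    unfolding pw Re_complex_of_real by (simp add: left_mult_one_mat[OF pow_carrier_mat])
  ultimately show ?thesis by simp
qed

text \<open>For Hermitian \<open>A\<close> the matrix A^H A is A^2, so the singular values are
  |\<nu>_k|. A single list \<open>\<nu>\<close> serves traces, eigenvalues and norm, so that an
  event about the norm can be read in terms of the power sums.\<close>

lemma hermitian_spec_norm:
  fixes A :: "complex mat"
  assumes A: "A \<in> carrier_mat n n" "mat_adjoint A = A" and n: "n > 0"
  obtains \<nu> :: "nat \<Rightarrow> real" where
    "\<And>a. mat_trace (A ^\<^sub>m a) = of_real (\<Sum>k<n. \<nu> k ^ a)"
    "{e. eigenvalue A e} = (\<lambda>k. of_real (\<nu> k)) ` {..<n}"
    "spec_norm A = Max ((\<lambda>k. \<bar>\<nu> k\<bar>) ` {..<n})"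
proof -
  obtain \<nu> :: "nat \<Rightarrow> real" where \<nu>: "\<And>a. mat_trace (A ^\<^sub>m a) = of_real (\<Sum>k<n. \<nu> k ^ a)"
    "\<And>a. {e. eigenvalue (A ^\<^sub>m a) e} = (\<lambda>k. of_real (\<nu> k ^ a)) ` {..<n}"
    using hermitian_mat_pow_trace[OF A] by metis
  have [simp]: "A ^\<^sub>m 1 = A" "A ^\<^sub>m 2 = A * A"
    using A by (auto simp: numeral_2_eq_2)
  have "Re ` {k. eigenvalue (mat_adjoint A * A) k} = (\<lambda>k. \<bar>\<nu> k\<bar>\<^sup>2) ` {..<n}"
    using \<nu>(2)[of 2] A(2) by (simp add: image_image)
  then have "spec_norm A = sqrt (Max ((\<lambda>x. x\<^sup>2) ` (\<lambda>k. \<bar>\<nu> k\<bar>) ` {..<n}))"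
    by (simp add: spec_norm_def image_image)
  also have "Max ((\<lambda>x. x\<^sup>2) ` (\<lambda>k. \<bar>\<nu> k\<bar>) ` {..<n}) = (Max ((\<lambda>k. \<bar>\<nu> k\<bar>) ` {..<n}))\<^sup>2"
  proof -
    define K where "K = (\<lambda>k. \<bar>\<nu> k\<bar>) ` {..<n}"
    have K: "finite K" "K \<noteq> {}" "\<And>x. x \<in> K \<Longrightarrow> x \<ge> 0"
      using n by (auto simp: K_def)
    then have "Max (power2 ` K) = (Max K)\<^sup>2"
      by (intro Max_eqI) (auto intro!: power_mono)
    then show ?thesis unfolding K_def .
  qed
  also have "sqrt \<dots> = \<bar>Max ((\<lambda>k. \<bar>\<nu> k\<bar>) ` {..<n})\<bar>" by simp
  also have "\<dots> = Max ((\<lambda>k. \<bar>\<nu> k\<bar>) ` {..<n})"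
    using n by (intro abs_of_nonneg) (subst Max_ge_iff; auto)
  finally show thesis using that[of \<nu>] \<nu>(1) \<nu>(2)[of 1] by simp
qed

section \<open>Laws with a Stein inequality\<close>

text \<open>
  The hypothesis on \<open>f\<close> and \<open>g\<close> forces \<open>f' \<le> 2 g\<close>, so for a Gaussian law the inequality is
  integration by parts; for a Rademacher law it is the hypothesis at \<open>x = 1\<close>, \<open>y = -1\<close>.
\<close>

definition stein_law :: "real measure \<Rightarrow> bool" where
  "stein_law \<mu> \<longleftrightarrow> prob_space \<mu> \<and> sets \<mu> = sets borel \<and> (\<forall>k. integrable \<mu> (\<lambda>x. x ^ k)) \<and>
     distr \<mu> borel uminus = \<mu> \<and>
     (\<forall>f g. real_polynomial_function f \<longrightarrow> real_polynomial_function g \<longrightarrow>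
        (\<forall>x y. (x - y) * (f x - f y) \<le> (x - y)\<^sup>2 * (g x + g y)) \<longrightarrow>
        0 \<le> (\<integral>x. 2 * g x - x * f x \<partial>\<mu>))"

lemma integrable_real_polynomial_function:
  fixes f :: "real \<Rightarrow> real"
  assumes "\<And>k. integrable M (\<lambda>x. x ^ k)" "real_polynomial_function f"
  shows "integrable M f"
proof -
  obtain a n where "f = (\<lambda>x. \<Sum>i\<le>n. a i * x ^ i)"
    using assms(2) unfolding real_polynomial_function_iff_sum by blast
  then show ?thesis using assms(1) by simp
qed

text \<open>Cancelling (y - x)^2 and letting y tend to x turns g y + g x into 2 g x; hence the
  factor 2 in \<open>stein_law\<close>.\<close>

lemma difference_quotient_bound_imp_deriv_le:
  fixes f g :: "real \<Rightarrow> real"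
  assumes le: "\<And>x y. (x - y) * (f x - f y) \<le> (x - y)\<^sup>2 * (g x + g y)"
    and f: "(f has_real_derivative D) (at x)" and g: "isCont g x"
  shows "D \<le> 2 * g x"
proof (rule tendsto_le)
  show "((\<lambda>y. (f y - f x) / (y - x)) \<longlongrightarrow> D) (at x)"
    using f unfolding has_field_derivative_iff .
  show "((\<lambda>y. g y + g x) \<longlongrightarrow> 2 * g x) (at x)"
    using g unfolding isCont_def by (auto intro!: tendsto_eq_intros)
  have "(f y - f x) / (y - x) \<le> g y + g x" if "y \<noteq> x" for y
  proof -
    have "(y - x) * (f y - f x) = (y - x)\<^sup>2 * ((f y - f x) / (y - x))"
      using that by (simp add: power2_eq_square)
    then have "(y - x)\<^sup>2 * ((f y - f x) / (y - x)) \<le> (y - x)\<^sup>2 * (g y + g x)"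
      using le[of y x] by simp
    then show ?thesis by (rule mult_left_le_imp_le) (use that in simp)
  qed
  then show "\<forall>\<^sub>F y in at x. (f y - f x) / (y - x) \<le> g y + g x"
    by (auto simp: eventually_at_filter)
qed auto

text \<open>The quotient is the double factorial (2j - 1)!!, the moment of order 2j of a standard
  normal variable.\<close>

lemma even_moment_const_rec:
  "(fact (2 * Suc j) :: real) / (2 ^ Suc j * fact (Suc j)) =
     (2 * real j + 1) * (fact (2 * j) / (2 ^ j * fact j))"
proof -
  have "(fact (2 * Suc j) :: real) = (2 * real j + 2) * ((2 * real j + 1) * fact (2 * j))"
    by (simp add: algebra_simps)
  moreover have "(2 :: real) ^ Suc j * fact (Suc j) = (2 * real j + 2) * (2 ^ j * fact j)"
    by (simp add: algebra_simps)
  moreover have "2 * real j + 2 \<noteq> 0" by linarith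
  ultimately show ?thesis
    by (simp only: mult_divide_mult_cancel_left times_divide_eq_right not_False_eq_True)
qed

text \<open>Gaussian integration by parts for the monomial x^k, read off from the closed formulas
  for the moments. For k = 0 the truncated \<open>k - 1\<close> is harmless because of the factor
  \<open>real k\<close>.\<close>

lemma std_normal_moment_rec:
  "(\<integral>x. std_normal_density x * x ^ Suc k \<partial>lborel) =
    real k * (\<integral>x. std_normal_density x * x ^ (k - 1) \<partial>lborel)"
proof (cases "even k")
  case True
  then obtain j where j: "k = 2 * j" by blast
  show ?thesis
  proof (cases j)
    case 0
    then show ?thesis using j integral_std_normal_moment_odd[of 0] by simp
  next
    case (Suc i)
    then show ?thesis
      using j integral_std_normal_moment_odd[of j] integral_std_normal_moment_odd[of i] by simp
  qed
next
  case False
  then obtain j where j: "k = 2 * j + 1" using oddE by blast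
  have "Suc k = 2 * Suc j" "k - 1 = 2 * j" using j by auto
  have "real k = 2 * real j + 1" using j by simp
  then show ?thesis
    unfolding \<open>Suc k = 2 * Suc j\<close> \<open>k - 1 = 2 * j\<close> integral_std_normal_moment_even
    by (simp only: even_moment_const_rec)
qed

lemma stein_law_std_normal: "stein_law (density lborel std_normal_density)"
proof -
  let ?\<mu> = "density lborel std_normal_density"
  have nn: "AE x in lborel. 0 \<le> std_normal_density x" by simp
  have mom: "integrable ?\<mu> (\<lambda>x. x ^ k)" for k
    using integrable_std_normal_moment[of k] by (simp add: integrable_density)
  have int: "(\<integral>x. x ^ k \<partial>?\<mu>) = (\<integral>x. std_normal_density x * x ^ k \<partial>lborel)" for k
    by (simp add: integral_density)
  note poly = integrable_real_polynomial_function[OF mom]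
  have sym: "distr ?\<mu> borel uminus = ?\<mu>"
  proof (rule measure_eqI)
    fix A :: "real set" assume "A \<in> sets (distr ?\<mu> borel uminus)"
    then have [measurable]: "A \<in> sets borel" by simp
    have "uminus -` A \<in> sets borel"
      using measurable_sets[of uminus borel borel A] by simp
    then have "emeasure (distr ?\<mu> borel uminus) A =
        (\<integral>\<^sup>+x. ennreal (std_normal_density x) * indicator (uminus -` A) x \<partial>lborel)"
      by (simp add: emeasure_distr emeasure_density)
    also have "\<dots> = (\<integral>\<^sup>+x. ennreal (std_normal_density x) * indicator (uminus -` A) x \<partial>distr lborel borel uminus)"
      by (simp add: lborel_distr_uminus)
    also have "\<dots> = (\<integral>\<^sup>+x. ennreal (std_normal_density x) * indicator A x \<partial>lborel)"
      by (subst nn_integral_distr)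
         (auto simp: normal_density_def indicator_def intro!: nn_integral_cong)
    also have "\<dots> = emeasure ?\<mu> A"
      by (simp add: emeasure_density)
    finally show "emeasure (distr ?\<mu> borel uminus) A = emeasure ?\<mu> A" .
  qed simp
  have "0 \<le> (\<integral>x. 2 * g x - x * f x \<partial>?\<mu>)"
    if f: "real_polynomial_function f" and g: "real_polynomial_function g"
      and le: "\<And>x y. (x - y) * (f x - f y) \<le> (x - y)\<^sup>2 * (g x + g y)" for f g
  proof -
    obtain a n where fa: "f = (\<lambda>x. \<Sum>i\<le>n. a i * x ^ i)"
      using f unfolding real_polynomial_function_iff_sum by blast
    define f' where "f' = (\<lambda>x. \<Sum>i\<le>n. a i * (real i * x ^ (i - 1)))"
    have "(f has_real_derivative f' x) (at x)" for x
      unfolding fa f'_def by (auto intro!: derivative_eq_intros sum.cong)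
    moreover have "isCont g x" for x
      using g by (rule continuous_real_polymonial_function)
    ultimately have f'_le: "f' x \<le> 2 * g x" for x
      using difference_quotient_bound_imp_deriv_le[OF le] by blast
    \<comment> \<open>Integration by parts for the polynomial \<open>f\<close>, monomial by
      monomial.\<close>
    have "(\<integral>x. x * f x \<partial>?\<mu>) = (\<Sum>i\<le>n. a i * (\<integral>x. x ^ Suc i \<partial>?\<mu>))"
    proof -
      have "(\<integral>x. x * f x \<partial>?\<mu>) = (\<integral>x. (\<Sum>i\<le>n. a i * x ^ Suc i) \<partial>?\<mu>)"
        unfolding fa by (simp add: sum_distrib_left mult_ac)
      also have "\<dots> = (\<Sum>i\<le>n. a i * (\<integral>x. x ^ Suc i \<partial>?\<mu>))"
        by (subst Bochner_Integration.integral_sum)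
           (rule integrable_mult_right mom | simp only: integral_mult_right_zero)+
      finally show ?thesis .
    qed
    also have "\<dots> = (\<Sum>i\<le>n. a i * (real i * (\<integral>x. x ^ (i - 1) \<partial>?\<mu>)))"
      unfolding int std_normal_moment_rec ..
    also have "\<dots> = (\<integral>x. f' x \<partial>?\<mu>)"
      unfolding f'_def using mom by simp
    finally have ibp: "(\<integral>x. x * f x \<partial>?\<mu>) = (\<integral>x. f' x \<partial>?\<mu>)" .
    have "real_polynomial_function (\<lambda>x. x * f x)"
      using f by (intro real_polynomial_function.intros(4)) (auto intro: real_polynomial_function.intros bounded_linear_ident)
    then have 1: "integrable ?\<mu> (\<lambda>x. x * f x)" by (rule poly)
    have 2: "integrable ?\<mu> f'" unfolding f'_def using mom by simp
    have 3: "integrable ?\<mu> g" using g by (rule poly)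
    have "(\<integral>x. 2 * g x - x * f x \<partial>?\<mu>) = (\<integral>x. 2 * g x - f' x \<partial>?\<mu>)"
      using 1 2 3 ibp by simp
    also have "\<dots> \<ge> 0" using f'_le by (intro Bochner_Integration.integral_nonneg) simp
    finally show ?thesis .
  qed
  then show ?thesis
    unfolding stein_law_def using prob_space_normal_density[of 1 0]
    by (intro conjI allI impI mom sym) simp_all
qed

lemma (in prob_space) stein_law_gaussian:
  assumes "std_gaussian_rv M X"
  shows "stein_law (distr M borel X)"
proof -
  have "distr M borel X = distr M lborel X" by (rule distr_cong) auto
  then show ?thesis
    using assms stein_law_std_normal unfolding std_gaussian_rv_def distributed_def by simp
qed

text \<open>The two atoms carry total mass 1, so almost surely \<open>h (X \<omega>)\<close> is a
  combination of the indicators of two events.\<close>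

lemma (in prob_space) rademacher_expectation:
  assumes X: "rademacher_rv M X" and [measurable]: "h \<in> borel_measurable borel"
  shows "integrable M (\<lambda>\<omega>. h (X \<omega>) :: real)" "(\<integral>\<omega>. h (X \<omega>) \<partial>M) = (h 1 + h (- 1)) / 2"
proof -
  have [measurable]: "X \<in> borel_measurable M"
    and p: "prob {\<omega> \<in> space M. X \<omega> = 1} = 1 / 2" "prob {\<omega> \<in> space M. X \<omega> = - 1} = 1 / 2"
    using X by (auto simp: rademacher_rv_def)
  let ?A = "{\<omega> \<in> space M. X \<omega> = 1}" and ?B = "{\<omega> \<in> space M. X \<omega> = - 1}"
  have "prob (?A \<union> ?B) = 1"
    using p by (subst finite_measure_Union) auto
  then have "AE \<omega> in M. \<omega> \<in> ?A \<union> ?B"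
    by (subst (asm) prob_eq_1) auto
  then have AE: "AE \<omega> in M. h 1 * indicator ?A \<omega> + h (- 1) * indicator ?B \<omega> = h (X \<omega>)"
    by eventually_elim (auto simp: indicator_def)
  have "has_bochner_integral M (\<lambda>\<omega>. h 1 * indicator ?A \<omega> + h (- 1) * indicator ?B \<omega>)
      (h 1 * prob ?A + h (- 1) * prob ?B)"
    by (intro has_bochner_integral_add has_bochner_integral_mult_right has_bochner_integral_real_indicator)
       (auto simp: emeasure_finite less_top[symmetric])
  from has_bochner_integral_cong_AE[THEN iffD1, OF _ _ AE this]
  have "has_bochner_integral M (\<lambda>\<omega>. h (X \<omega>)) ((h 1 + h (- 1)) / 2)"
    by (simp add: p add_divide_distrib)
  then show "integrable M (\<lambda>\<omega>. h (X \<omega>))" "(\<integral>\<omega>. h (X \<omega>) \<partial>M) = (h 1 + h (- 1)) / 2"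
    by (auto simp: has_bochner_integral_iff)
qed

lemma (in prob_space) stein_law_rademacher:
  assumes X: "rademacher_rv M X"
  shows "stein_law (distr M borel X)"
proof -
  have [measurable]: "X \<in> borel_measurable M"
    using X by (simp add: rademacher_rv_def)
  interpret D: prob_space "distr M borel X" by (rule prob_space_distr) simp
  let ?\<mu> = "distr M borel X"
  have E: "integrable ?\<mu> h" "(\<integral>x. h x \<partial>?\<mu>) = (h 1 + h (- 1)) / 2"
    if [measurable]: "h \<in> borel_measurable borel" for h :: "real \<Rightarrow> real"
    using rademacher_expectation[OF X that] by (simp_all add: integrable_distr_eq integral_distr)
  have "distr ?\<mu> borel uminus = ?\<mu>"
  proof (rule measure_eqI)
    fix A :: "real set" assume "A \<in> sets (distr ?\<mu> borel uminus)"
    then have [measurable]: "A \<in> sets borel" by simp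
    have "measure (distr ?\<mu> borel uminus) A = (\<integral>x. indicator A (- x) \<partial>?\<mu>)"
      using integral_distr[of uminus ?\<mu> borel "indicator A :: real \<Rightarrow> real"] by simp
    also have "\<dots> = (\<integral>x. indicator A x \<partial>?\<mu>)"
      by (subst (1 2) E) auto
    also have "\<dots> = measure ?\<mu> A" by simp
    finally show "emeasure (distr ?\<mu> borel uminus) A = emeasure ?\<mu> A"
      by (simp add: emeasure_distr D.emeasure_eq_measure measure_distr)
  qed simp
  moreover have "0 \<le> (\<integral>x. 2 * g x - x * f x \<partial>?\<mu>)"
    if f: "real_polynomial_function f" and g: "real_polynomial_function g"
      and le: "\<And>x y. (x - y) * (f x - f y) \<le> (x - y)\<^sup>2 * (g x + g y)" for f g
  proof -
    have [measurable]: "f \<in> borel_measurable borel" "g \<in> borel_measurable borel"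
      using f g by (auto intro!: borel_measurable_continuous_onI continuous_at_imp_continuous_on continuous_real_polymonial_function)
    \<comment> \<open>At 1 and -1 the hypothesis reads 2 (f 1 - f (-1)) <= 4 (g 1 + g (-1)), and the
      right side minus the left side is four times the integral.\<close>
    show ?thesis
      using le[of 1 "- 1"] by (subst E(2)) (auto simp: power2_eq_square)
  qed
  ultimately show ?thesis
    unfolding stein_law_def using D.prob_space_axioms by (intro conjI allI impI E(1)) simp_all
qed

section \<open>Moments of matrix series\<close>

inductive coord_poly :: "'i set \<Rightarrow> (('i \<Rightarrow> real) \<Rightarrow> real) \<Rightarrow> bool" for I where
  const: "coord_poly I (\<lambda>_. c)"
| coord: "i \<in> I \<Longrightarrow> coord_poly I (\<lambda>z. z i)"
| add: "coord_poly I f \<Longrightarrow> coord_poly I g \<Longrightarrow> coord_poly I (\<lambda>z. f z + g z)"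
| mult: "coord_poly I f \<Longrightarrow> coord_poly I g \<Longrightarrow> coord_poly I (\<lambda>z. f z * g z)"

lemma coord_poly_diff:
  assumes "coord_poly I f" "coord_poly I g"
  shows "coord_poly I (\<lambda>z. f z - g z)"
  using coord_poly.add[OF assms(1) coord_poly.mult[OF coord_poly.const[of _ "- 1"] assms(2)]] by simp

lemma coord_poly_sum:
  "(\<And>i. i \<in> A \<Longrightarrow> coord_poly I (f i)) \<Longrightarrow> coord_poly I (\<lambda>z. \<Sum>i\<in>A. f i z)"
  by (induction A rule: infinite_finite_induct) (auto intro: coord_poly.intros)

text \<open>With the other coordinates frozen, the function is of the one-variable kind that
  \<open>stein_law\<close> quantifies over.\<close>

lemma coord_poly_slice:
  assumes "coord_poly I f"
  shows "real_polynomial_function (\<lambda>y. f (x(i := y)))"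
  using assms
proof induction
  case (coord j)
  show ?case
    by (cases "j = i") (auto intro: real_polynomial_function.intros bounded_linear_ident)
qed (auto intro: real_polynomial_function.intros)

text \<open>Integrability alone does not pass to products, so the induction carries integrability of
  all powers of |f|: then |f g|^k is dominated by |f|^(2k) + |g|^(2k), and |f + g|^k by 2^k (|f|^k +
  |g|^k).\<close>

lemma integrable_coord_poly:
  assumes f: "coord_poly I f"
    and prob: "\<And>i. i \<in> I \<Longrightarrow> prob_space (\<mu> i)"
    and sets: "\<And>i. i \<in> I \<Longrightarrow> sets (\<mu> i) = sets borel"
    and mom: "\<And>i k. i \<in> I \<Longrightarrow> integrable (\<mu> i) (\<lambda>x. x ^ k)"
  shows "integrable (Pi\<^sub>M I \<mu>) f"
proof -
  interpret P: prob_space "Pi\<^sub>M I \<mu>"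
    by (intro prob_space_PiM prob)
  have "f \<in> borel_measurable (Pi\<^sub>M I \<mu>) \<and> (\<forall>k. integrable (Pi\<^sub>M I \<mu>) (\<lambda>z. \<bar>f z\<bar> ^ k))"
    using f
  proof induction
    case (coord i)
    have i [measurable]: "(\<lambda>z. z i) \<in> measurable (Pi\<^sub>M I \<mu>) (\<mu> i)"
      using coord by simp
    have "(\<lambda>z. z i) \<in> borel_measurable (Pi\<^sub>M I \<mu>)"
      using i sets[OF coord] measurable_cong_sets by blast
    moreover have "integrable (Pi\<^sub>M I \<mu>) (\<lambda>z. \<bar>z i\<bar> ^ k)" for k
    proof -
      have "integrable (distr (Pi\<^sub>M I \<mu>) (\<mu> i) (\<lambda>z. z i)) (\<lambda>x. \<bar>x\<bar> ^ k)"
        using integrable_abs[OF mom[OF coord, of k]]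
        by (subst distr_PiM_component) (auto simp: prob coord power_abs)
      then show ?thesis
        by (subst (asm) integrable_distr_eq)
           (auto simp: measurable_cong_sets[OF sets[OF coord] refl])
    qed
    ultimately show ?case by simp
  next
    case (add f g)
    then have [measurable]: "f \<in> borel_measurable (Pi\<^sub>M I \<mu>)" "g \<in> borel_measurable (Pi\<^sub>M I \<mu>)"
      by auto
    have "integrable (Pi\<^sub>M I \<mu>) (\<lambda>z. \<bar>f z + g z\<bar> ^ k)" for k
    proof (rule Bochner_Integration.integrable_bound)
      show "integrable (Pi\<^sub>M I \<mu>) (\<lambda>z. 2 ^ k * (\<bar>f z\<bar> ^ k + \<bar>g z\<bar> ^ k))"
        using add by auto
      have "\<bar>f z + g z\<bar> ^ k \<le> 2 ^ k * (\<bar>f z\<bar> ^ k + \<bar>g z\<bar> ^ k)" for z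
      proof -
        have "\<bar>f z + g z\<bar> ^ k \<le> (2 * max \<bar>f z\<bar> \<bar>g z\<bar>) ^ k"
          by (intro power_mono) auto
        also have "\<dots> \<le> 2 ^ k * (\<bar>f z\<bar> ^ k + \<bar>g z\<bar> ^ k)"
          unfolding power_mult_distrib by (intro mult_left_mono) (auto simp: max_def)
        finally show ?thesis .
      qed
      then show "AE z in Pi\<^sub>M I \<mu>. norm (\<bar>f z + g z\<bar> ^ k) \<le> norm (2 ^ k * (\<bar>f z\<bar> ^ k + \<bar>g z\<bar> ^ k))"
        by (intro AE_I2) (auto intro: order_trans)
    qed simp
    then show ?case by simp
  next
    case (mult f g)
    then have [measurable]: "f \<in> borel_measurable (Pi\<^sub>M I \<mu>)" "g \<in> borel_measurable (Pi\<^sub>M I \<mu>)"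
      by auto
    have int: "\<And>k. integrable (Pi\<^sub>M I \<mu>) (\<lambda>z. \<bar>f z\<bar> ^ k)" "\<And>k. integrable (Pi\<^sub>M I \<mu>) (\<lambda>z. \<bar>g z\<bar> ^ k)"
      using mult by auto
    have "integrable (Pi\<^sub>M I \<mu>) (\<lambda>z. \<bar>f z * g z\<bar> ^ k)" for k
    proof (rule Bochner_Integration.integrable_bound)
      show "integrable (Pi\<^sub>M I \<mu>) (\<lambda>z. \<bar>f z\<bar> ^ (2 * k) + \<bar>g z\<bar> ^ (2 * k))"
        by (intro Bochner_Integration.integrable_add int)
      have "\<bar>f z * g z\<bar> ^ k \<le> \<bar>f z\<bar> ^ (2 * k) + \<bar>g z\<bar> ^ (2 * k)" for z
      proof -
        define a b where "a = \<bar>f z\<bar> ^ k" and "b = \<bar>g z\<bar> ^ k"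
        have "0 \<le> a" "0 \<le> b" by (auto simp: a_def b_def)
        then have "a * b \<le> a * a + b * b"
          using sum_squares_bound[of a b] mult_nonneg_nonneg[of a b]
          unfolding power2_eq_square mult.assoc by linarith
        then show ?thesis
          unfolding a_def b_def by (simp add: mult_2 power_add abs_mult power_mult_distrib del: power_even_abs)
      qed
      then show "AE z in Pi\<^sub>M I \<mu>. norm (\<bar>f z * g z\<bar> ^ k) \<le> norm (\<bar>f z\<bar> ^ (2 * k) + \<bar>g z\<bar> ^ (2 * k))"
        by (intro AE_I2) (auto intro: order_trans)
    qed simp
    then show ?case by simp
  qed auto
  then have "integrable (Pi\<^sub>M I \<mu>) (\<lambda>z. \<bar>f z\<bar> ^ 1)" and [measurable]: "f \<in> borel_measurable (Pi\<^sub>M I \<mu>)"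
    by blast+
  then show ?thesis
    by (subst integrable_abs_iff[symmetric]) auto
qed

section \<open>Matrix series as functions of their coefficients\<close>

lemma smult_mat_pow:
  fixes A :: "complex mat"
  assumes A: "A \<in> carrier_mat n n"
  shows "(c \<cdot>\<^sub>m A) ^\<^sub>m k = c ^ k \<cdot>\<^sub>m A ^\<^sub>m k"
proof (induction k)
  case (Suc k)
  have "(c \<cdot>\<^sub>m A) ^\<^sub>m Suc k = (c ^ k \<cdot>\<^sub>m A ^\<^sub>m k) * (c \<cdot>\<^sub>m A)"
    by (simp add: Suc)
  also have "\<dots> = c ^ Suc k \<cdot>\<^sub>m A ^\<^sub>m Suc k"
    using pow_carrier_mat[OF A, of k] A
    by (auto intro!: eq_matI simp: mult_ac)
  finally show ?case .
qed (use A in \<open>auto intro!: eq_matI\<close>)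

lemma mat_trace_smult:
  assumes "A \<in> carrier_mat n n"
  shows "mat_trace (c \<cdot>\<^sub>m A) = c * mat_trace A"
  using assms by (auto simp: mat_trace_def sum_distrib_left)

text \<open>\<open>n\<close> is the size of the matrices, while the summands are indexed by
  \<open>I\<close>. The laws may differ between coordinates. \<open>law\<close> is stated for every
  index because the sigma-finiteness behind the iterated product integral is.\<close>

locale stein_matrix_series =
  fixes I :: "'i set" and \<mu> :: "'i \<Rightarrow> real measure" and B :: "'i \<Rightarrow> complex mat" and n :: nat
  assumes fin: "finite I"
    and law: "\<And>i. stein_law (\<mu> i)"
    and B: "\<And>i. i \<in> I \<Longrightarrow> B i \<in> carrier_mat n n" "\<And>i. i \<in> I \<Longrightarrow> mat_adjoint (B i) = B i"
begin

abbreviation "P \<equiv> Pi\<^sub>M I \<mu>"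

definition X :: "('i \<Rightarrow> real) \<Rightarrow> complex mat" where
  "X z = mat n n (\<lambda>(a, b). \<Sum>i\<in>I. of_real (z i) * B i $$ (a, b))"

definition V :: "complex mat" where
  "V = mat n n (\<lambda>(a, b). \<Sum>i\<in>I. (B i * B i) $$ (a, b))"

definition moment :: "nat \<Rightarrow> real" where
  "moment k = (\<integral>z. Re (mat_trace (X z ^\<^sub>m k)) \<partial>P)"

lemma X_carrier [simp]: "X z \<in> carrier_mat n n"
  by (simp add: X_def)

lemma X_pow_carrier [simp]: "X z ^\<^sub>m k \<in> carrier_mat n n"
  by (intro pow_carrier_mat X_carrier)

lemma V_carrier [simp]: "V \<in> carrier_mat n n"
  by (simp add: V_def)

lemma X_cong: "(\<And>i. i \<in> I \<Longrightarrow> z i = z' i) \<Longrightarrow> X z = X z'"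
  by (auto simp: X_def intro!: eq_matI)

lemma B_sym: "i \<in> I \<Longrightarrow> a < n \<Longrightarrow> b < n \<Longrightarrow> cnj (B i $$ (b, a)) = B i $$ (a, b)"
  using index_mat_adjoint[of a "B i" b] B[of i] by simp

lemma X_hermitian: "mat_adjoint (X z) = X z"
  by (intro eq_matI) (auto simp: X_def B_sym)

lemma V_hermitian: "mat_adjoint V = V"
proof -
  have "mat_adjoint (B i * B i) = B i * B i" if "i \<in> I" for i
    using mat_adjoint_mult[of "B i" n n "B i" n] B[OF that] by simp
  then have "cnj ((B i * B i) $$ (b, a)) = (B i * B i) $$ (a, b)" if "i \<in> I" "a < n" "b < n" for i a b
    using index_mat_adjoint[of a "B i * B i" b] B(1)[of i] that by auto
  then show ?thesis
    by (intro eq_matI) (auto simp: V_def simp del: index_mult_mat)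
qed

lemma trace_X_mult:
  assumes "M \<in> carrier_mat n n"
  shows "mat_trace (X z * M) = (\<Sum>i\<in>I. of_real (z i) * mat_trace (B i * M))"
proof -
  have "mat_trace (X z * M) = (\<Sum>a<n. \<Sum>b<n. \<Sum>i\<in>I. of_real (z i) * B i $$ (a, b) * M $$ (b, a))"
    by (simp add: mat_trace_mult[OF X_carrier assms]) (simp add: X_def sum_distrib_right)
  also have "\<dots> = (\<Sum>a<n. \<Sum>i\<in>I. \<Sum>b<n. of_real (z i) * B i $$ (a, b) * M $$ (b, a))"
    by (intro sum.cong refl sum.swap)
  also have "\<dots> = (\<Sum>i\<in>I. \<Sum>a<n. \<Sum>b<n. of_real (z i) * B i $$ (a, b) * M $$ (b, a))"
    by (rule sum.swap)
  also have "\<dots> = (\<Sum>i\<in>I. of_real (z i) * mat_trace (B i * M))"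
    by (intro sum.cong refl) (simp add: mat_trace_mult[OF B(1) assms] sum_distrib_left mult.assoc)
  finally show ?thesis .
qed

lemma trace_V_mult:
  assumes "M \<in> carrier_mat n n"
  shows "mat_trace (V * M) = (\<Sum>i\<in>I. mat_trace (B i * B i * M))"
proof -
  have c: "B i * B i \<in> carrier_mat n n" if "i \<in> I" for i
    using B(1)[OF that] by (intro mult_carrier_mat[of _ n n])
  have "mat_trace (V * M) = (\<Sum>a<n. \<Sum>b<n. \<Sum>i\<in>I. (B i * B i) $$ (a, b) * M $$ (b, a))"
    by (simp add: mat_trace_mult[OF V_carrier assms]) (simp add: V_def sum_distrib_right)
  also have "\<dots> = (\<Sum>a<n. \<Sum>i\<in>I. \<Sum>b<n. (B i * B i) $$ (a, b) * M $$ (b, a))"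
    by (intro sum.cong refl sum.swap)
  also have "\<dots> = (\<Sum>i\<in>I. \<Sum>a<n. \<Sum>b<n. (B i * B i) $$ (a, b) * M $$ (b, a))"
    by (rule sum.swap)
  also have "\<dots> = (\<Sum>i\<in>I. mat_trace (B i * B i * M))"
    by (intro sum.cong refl) (simp add: mat_trace_mult[OF c assms])
  finally show ?thesis .
qed

lemma coord_poly_X_pow:
  assumes "a < n" "b < n"
  shows "coord_poly I (\<lambda>z. Re ((X z ^\<^sub>m k) $$ (a, b))) \<and> coord_poly I (\<lambda>z. Im ((X z ^\<^sub>m k) $$ (a, b)))"
  using assms
proof (induction k arbitrary: a b)
  case 0
  then show ?case by (auto simp: X_def intro: coord_poly.const)
next
  case (Suc k)
  have X: "coord_poly I (\<lambda>z. Re (X z $$ (c, b)))" "coord_poly I (\<lambda>z. Im (X z $$ (c, b)))" if "c < n" for c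
    using that Suc.prems
    by (auto simp: X_def intro!: coord_poly_sum coord_poly.intros)
  have *: "(X z ^\<^sub>m Suc k) $$ (a, b) = (\<Sum>c<n. (X z ^\<^sub>m k) $$ (a, c) * X z $$ (c, b))" for z
    using Suc.prems X_pow_carrier[of z k] X_carrier[of z]
    by (auto simp: scalar_prod_def atLeast0LessThan simp del: X_pow_carrier X_carrier)
  show ?case
    unfolding * Re_sum Im_sum using Suc.IH[OF Suc.prems(1)] X
    by (auto intro!: coord_poly_sum coord_poly.add coord_poly.mult coord_poly_diff)
qed

lemma coord_poly_trace:
  assumes "C \<in> carrier_mat n n"
  shows "coord_poly I (\<lambda>z. Re (mat_trace (C * X z ^\<^sub>m k)))"
  unfolding mat_trace_mult[OF assms X_pow_carrier] Re_sum times_complex.sel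
  by (intro coord_poly_sum coord_poly_diff coord_poly.mult coord_poly.const)
     (auto simp: coord_poly_X_pow)

lemma integrable_P:
  assumes "coord_poly I f"
  shows "integrable P f"
  using law by (intro integrable_coord_poly[OF assms]) (auto simp: stein_law_def)

lemma integrable_trace_X_pow: "integrable P (\<lambda>z. Re (mat_trace (X z ^\<^sub>m k)))"
  using integrable_P[OF coord_poly_trace[of "1\<^sub>m n" k]]
  by (simp add: left_mult_one_mat[OF X_pow_carrier])

lemma X_update_diff:
  assumes "i \<in> I" "a < n" "b < n"
  shows "X (z(i := x)) $$ (a, b) - X (z(i := y)) $$ (a, b) = of_real (x - y) * B i $$ (a, b)"
proof -
  have "X (z(i := x)) $$ (a, b) - X (z(i := y)) $$ (a, b) =
      (\<Sum>j\<in>I. if j = i then of_real (x - y) * B i $$ (a, b) else 0)"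
    unfolding X_def using assms
    by (auto simp: left_diff_distrib simp flip: sum_subtractf intro!: sum.cong)
  also have "\<dots> = of_real (x - y) * B i $$ (a, b)"
    using assms fin by simp
  finally show ?thesis .
qed

text \<open>The product structure of \<open>P\<close> allows integrating over coordinate
  \<open>i\<close> first. With the others frozen, \<open>trace_mean_value_inequality\<close> for c =
  x - y is the hypothesis of \<open>stein_law\<close> for the slices of \<open>f\<close> and
  \<open>g\<close>. The 1/2 in \<open>g\<close> cancels the 2 in \<open>stein_law\<close>.\<close>

lemma stein_inequality:
  assumes i: "i \<in> I"
  shows "(\<integral>z. z i * Re (mat_trace (B i * X z ^\<^sub>m (2 * r + 1))) \<partial>P) \<le>
    (2 * real r + 1) * (\<integral>z. Re (mat_trace (B i * B i * X z ^\<^sub>m (2 * r))) \<partial>P)"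
proof -
  interpret product_sigma_finite \<mu>
    using law by (auto simp: product_sigma_finite_def stein_law_def prob_space_imp_sigma_finite)
  define f where "f z = Re (mat_trace (B i * X z ^\<^sub>m (2 * r + 1)))" for z
  define g where "g z = (2 * real r + 1) / 2 * Re (mat_trace (B i * B i * X z ^\<^sub>m (2 * r)))" for z
  have BB: "B i * B i \<in> carrier_mat n n"
    using B(1)[OF i] by (intro mult_carrier_mat[of _ n n])
  have f: "coord_poly I f" and g: "coord_poly I g"
    unfolding f_def g_def
    by (intro coord_poly_trace B(1) i coord_poly.mult coord_poly.const BB)+
  have zf: "coord_poly I (\<lambda>z. z i * f z)"
    by (intro coord_poly.mult coord_poly.coord i f)
  have h: "integrable P (\<lambda>z. 2 * g z - z i * f z)"
    by (intro integrable_P coord_poly_diff zf coord_poly.mult coord_poly.const g)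
  have slice: "0 \<le> (\<integral>y. 2 * g (z(i := y)) - y * f (z(i := y)) \<partial>\<mu> i)" for z
  proof -
    have "(x - y) * (f (z(i := x)) - f (z(i := y))) \<le> (x - y)\<^sup>2 * (g (z(i := x)) + g (z(i := y)))" for x y
      unfolding f_def g_def
      by (intro trace_mean_value_inequality[of _ n] B i X_carrier X_hermitian X_update_diff)
    then show ?thesis
      using law[of i] coord_poly_slice[OF f, of z i] coord_poly_slice[OF g, of z i]
      unfolding stein_law_def by blast
  qed
  have I: "insert i (I - {i}) = I" using i by auto
  have "(\<integral>z. 2 * g z - z i * f z \<partial>P) = (\<integral>z. (\<integral>y. 2 * g (z(i := y)) - y * f (z(i := y)) \<partial>\<mu> i) \<partial>Pi\<^sub>M (I - {i}) \<mu>)"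
    using product_integral_insert[of "I - {i}" i "\<lambda>z. 2 * g z - z i * f z", unfolded I] fin h by simp
  also have "\<dots> \<ge> 0"
    by (rule Bochner_Integration.integral_nonneg) (rule slice)
  finally have "0 \<le> (\<integral>z. 2 * g z - z i * f z \<partial>P)" .
  also have "\<dots> = 2 * (\<integral>z. g z \<partial>P) - (\<integral>z. z i * f z \<partial>P)"
    using integrable_P[OF g] integrable_P[OF zf] by simp
  finally show ?thesis by (simp add: f_def g_def)
qed

text \<open>Splitting off one factor \<open>X\<close> and expanding it over \<open>I\<close>
  produces the terms of \<open>stein_inequality\<close>. Their bounds contain the squares of the
  \<open>B i\<close>, which add up to \<open>V\<close>, and \<open>V\<close> is replaced by
  \<open>s\<close> pointwise.\<close>

lemma moment_rec:
  assumes s: "\<And>e. eigenvalue V e \<Longrightarrow> Re e \<le> s"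
  shows "moment (2 * Suc r) \<le> (2 * real r + 1) * (s * moment (2 * r))"
proof -
  have iB: "integrable P (\<lambda>z. Re (mat_trace (B i * B i * X z ^\<^sub>m (2 * r))))" if "i \<in> I" for i
    using B(1)[OF that] by (intro integrable_P coord_poly_trace mult_carrier_mat[of _ n n])
  have "moment (2 * Suc r) = (\<integral>z. (\<Sum>i\<in>I. z i * Re (mat_trace (B i * X z ^\<^sub>m (2 * r + 1)))) \<partial>P)"
    unfolding moment_def
  proof (intro Bochner_Integration.integral_cong refl)
    fix z
    have "X z ^\<^sub>m (2 * Suc r) = X z * X z ^\<^sub>m (2 * r + 1)"
      using mult_pow_mat_left[OF X_carrier, of z "2 * r + 1"] by simp
    then show "Re (mat_trace (X z ^\<^sub>m (2 * Suc r))) = (\<Sum>i\<in>I. z i * Re (mat_trace (B i * X z ^\<^sub>m (2 * r + 1))))"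
      by (simp only: trace_X_mult[OF X_pow_carrier] Re_sum) simp
  qed
  also have "\<dots> = (\<Sum>i\<in>I. \<integral>z. z i * Re (mat_trace (B i * X z ^\<^sub>m (2 * r + 1))) \<partial>P)"
    by (intro Bochner_Integration.integral_sum integrable_P coord_poly.mult coord_poly.coord coord_poly_trace B(1))
  also have "\<dots> \<le> (\<Sum>i\<in>I. (2 * real r + 1) * (\<integral>z. Re (mat_trace (B i * B i * X z ^\<^sub>m (2 * r))) \<partial>P))"
    by (intro sum_mono stein_inequality)
  also have "\<dots> = (2 * real r + 1) * (\<integral>z. (\<Sum>i\<in>I. Re (mat_trace (B i * B i * X z ^\<^sub>m (2 * r)))) \<partial>P)"
    using iB by (simp add: sum_distrib_left)
  also have "(\<integral>z. (\<Sum>i\<in>I. Re (mat_trace (B i * B i * X z ^\<^sub>m (2 * r)))) \<partial>P) \<le> (\<integral>z. s * Re (mat_trace (X z ^\<^sub>m (2 * r))) \<partial>P)"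
  proof (intro integral_mono)
    fix z
    show "(\<Sum>i\<in>I. Re (mat_trace (B i * B i * X z ^\<^sub>m (2 * r)))) \<le> s * Re (mat_trace (X z ^\<^sub>m (2 * r)))"
      using trace_mult_even_power_le[OF V_carrier V_hermitian X_carrier X_hermitian s, of z r]
      by (simp add: trace_V_mult)
  qed (use iB integrable_trace_X_pow in auto)
  also have "\<dots> = s * moment (2 * r)"
    by (simp add: moment_def)
  finally show ?thesis by (simp add: mult_left_mono)
qed

lemma even_moment_le:
  assumes s: "\<And>e. eigenvalue V e \<Longrightarrow> Re e \<le> s" "0 \<le> s"
  shows "moment (2 * r) \<le> real n * (fact (2 * r) / (2 ^ r * fact r) * s ^ r)"
proof (induction r)
  case 0
  interpret prob_space P
    using law by (intro prob_space_PiM) (auto simp: stein_law_def)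
  have "mat_trace (X z ^\<^sub>m 0) = of_nat n" for z
    by (simp add: X_def mat_trace_def)
  then show ?case by (simp add: moment_def prob_space)
next
  case (Suc r)
  have "moment (2 * Suc r) \<le> (2 * real r + 1) * (s * moment (2 * r))"
    by (rule moment_rec[OF s(1)])
  also have "\<dots> \<le> (2 * real r + 1) * (s * (real n * (fact (2 * r) / (2 ^ r * fact r) * s ^ r)))"
    by (intro mult_left_mono Suc s) auto
  also have "\<dots> = real n * (fact (2 * Suc r) / (2 ^ Suc r * fact (Suc r)) * s ^ Suc r)"
    unfolding even_moment_const_rec by simp
  finally show ?case .
qed

text \<open>Negating all coefficients preserves \<open>P\<close> and multiplies X^k by (-1)^k, so
  the moment equals its own negative.\<close>

lemma odd_moment:
  assumes "odd k"
  shows "moment k = 0"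
proof -
  have prob: "\<And>i. prob_space (\<mu> i)" and [measurable_cong]: "\<And>i. sets (\<mu> i) = sets borel"
    and sym: "\<And>i. distr (\<mu> i) borel uminus = \<mu> i"
    using law by (auto simp: stein_law_def)
  have sym': "distr (\<mu> i) (\<mu> i) uminus = \<mu> i" for i
    using sym[of i] by (metis distr_cong law stein_law_def)
  have m: "uminus \<in> measurable (\<mu> i) (\<mu> i)" for i
    by (simp add: measurable_cong_sets[OF \<open>sets (\<mu> i) = sets borel\<close> \<open>sets (\<mu> i) = sets borel\<close>])
  \<comment> \<open>\<open>compose I uminus\<close> negates on \<open>I\<close> and is undefined
    elsewhere, so it maps into the space of the product measure.\<close>
  have P: "distr P P (compose I uminus) = P"
    by (subst distr_PiM_finite_prob_space') (auto simp: fin prob m sym')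
  have meas: "compose I uminus \<in> measurable P P"
    unfolding compose_def
  proof (intro measurable_restrict)
    fix i assume "i \<in> I"
    then have "(\<lambda>z. z i) \<in> measurable P (\<mu> i)" by simp
    from measurable_compose[OF this m[of i]] show "(\<lambda>z. - z i) \<in> measurable P (\<mu> i)" .
  qed
  have X_minus: "X (compose I uminus z) = (- 1) \<cdot>\<^sub>m X z" for z
    by (intro eq_matI) (auto simp: X_def compose_def sum_negf)
  have "mat_trace ((- 1) ^ k \<cdot>\<^sub>m X z ^\<^sub>m k) = - mat_trace (X z ^\<^sub>m k)" for z
    using assms by (simp add: mat_trace_smult[OF X_pow_carrier])
  then have neg: "mat_trace (X (compose I uminus z) ^\<^sub>m k) = - mat_trace (X z ^\<^sub>m k)" for z
    unfolding X_minus smult_mat_pow[OF X_carrier] .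
  have "moment k = (\<integral>z. Re (mat_trace (X z ^\<^sub>m k)) \<partial>distr P P (compose I uminus))"
    by (simp add: P moment_def)
  also have "\<dots> = (\<integral>z. Re (mat_trace (X (compose I uminus z) ^\<^sub>m k)) \<partial>P)"
    using integrable_trace_X_pow[of k] by (intro integral_distr meas) auto
  also have "\<dots> = - moment k"
    by (simp add: neg moment_def)
  finally show ?thesis by simp
qed

end

section \<open>Tail bounds\<close>

lemma sum_even_indices:
  fixes F :: "nat \<Rightarrow> 'a :: comm_monoid_add"
  shows "(\<Sum>k\<le>2 * N. if even k then F (k div 2) else 0) = (\<Sum>r\<le>N. F r)"
  by (induction N) (simp_all add: atMost_Suc)

lemma sum_le_exp:
  fixes x :: real
  assumes "0 \<le> x"
  shows "(\<Sum>r\<le>N. x ^ r / fact r) \<le> exp x"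
proof -
  have "(\<Sum>r\<le>N. x ^ r /\<^sub>R fact r) \<le> exp x"
    unfolding exp_def using assms by (intro sum_le_suminf summable_exp_generic) auto
  then show ?thesis by (simp add: divide_real_def mult.commute)
qed

text \<open>For y < 0 the Lagrange remainder of degree 2N + 1 has the sign of y^(2N+1), so the
  truncation is at least exp y. In a trace of the truncation all eigenvalues but one can therefore
  be discarded.\<close>

lemma even_exp_truncation_nonneg:
  fixes y :: real
  shows "0 \<le> (\<Sum>k\<le>2 * N. y ^ k / fact k)"
proof (cases "y < 0")
  case True
  then obtain t where "exp y = (\<Sum>m<2 * N + 1. y ^ m / fact m) + exp t / fact (2 * N + 1) * y ^ (2 * N + 1)"
    using Maclaurin_exp_lt[of y "2 * N + 1"] by auto
  moreover have "exp t / fact (2 * N + 1) * y ^ (2 * N + 1) \<le> 0"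
    using True by (intro mult_nonneg_nonpos) (auto simp: mult_le_0_iff)
  ultimately show ?thesis
    using exp_gt_zero[of y] by (simp add: lessThan_Suc_atMost)
qed (auto intro!: sum_nonneg)

text \<open>A non-measurable \<open>E\<close> has \<open>prob E = 0\<close>, so measurability of the event is never needed.\<close>

lemma (in prob_space) markov_inequality_subset:
  assumes E: "E \<subseteq> space M" and T: "integrable M T" "\<And>\<omega>. 0 \<le> T \<omega>"
    and q: "\<And>\<omega>. \<omega> \<in> E \<Longrightarrow> q \<le> T \<omega>"
  shows "prob E * q \<le> expectation T"
proof (cases "E \<in> events")
  case True
  have int: "integrable M (\<lambda>\<omega>. q * indicator E \<omega>)"
    using True by (intro integrable_mult_right integrable_real_indicator) (auto simp: emeasure_finite less_top[symmetric])
  have "prob E * q = expectation (\<lambda>\<omega>. q * indicator E \<omega>)"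
    using True E by (simp add: Int_absorb2)
  also have "\<dots> \<le> expectation T"
    using T q by (intro integral_mono int) (auto simp: indicator_def)
  finally show ?thesis .
next
  case False
  then show ?thesis
    using T by (simp add: measure_notin_sets)
qed

context stein_matrix_series
begin

text \<open>Bounding \<open>c\<close> only from above by the coefficients of exp covers exp and cosh
  alike: odd terms vanish, and each even one is at most a term of the series of n exp (u^2 s /
  2).\<close>

lemma weighted_moments_le:
  assumes s: "\<And>e. eigenvalue V e \<Longrightarrow> Re e \<le> s" "0 \<le> s"
    and c: "\<And>k. 0 \<le> c k" "\<And>k. c k \<le> u ^ k / fact k"
  shows "(\<Sum>k\<le>2 * N. c k * moment k) \<le> real n * exp (u\<^sup>2 * s / 2)"
proof -
  define F where "F r = real n * ((u\<^sup>2 * s / 2) ^ r / fact r)" for r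
  have "c k * moment k \<le> (if even k then F (k div 2) else 0)" for k
  proof (cases "even k")
    case True
    then obtain r where r: "k = 2 * r" by blast
    define b where "b = real n * (fact (2 * r) / (2 ^ r * fact r) * s ^ r)"
    have "c k * moment k \<le> c k * b"
      unfolding r b_def by (intro mult_left_mono even_moment_le s c)
    also have "\<dots> \<le> u ^ k / fact k * b"
      using s(2) by (intro mult_right_mono c) (auto simp: b_def)
    also have "\<dots> = F r"
      by (simp add: F_def b_def r power_mult power_mult_distrib power_divide)
    finally show ?thesis by (simp add: r)
  qed (simp add: odd_moment)
  then have "(\<Sum>k\<le>2 * N. c k * moment k) \<le> (\<Sum>k\<le>2 * N. if even k then F (k div 2) else 0)"
    by (intro sum_mono)
  also have "\<dots> = (\<Sum>r\<le>N. F r)"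
    by (rule sum_even_indices)
  also have "\<dots> = real n * (\<Sum>r\<le>N. (u\<^sup>2 * s / 2) ^ r / fact r)"
    by (simp add: F_def sum_distrib_left)
  also have "\<dots> \<le> real n * exp (u\<^sup>2 * s / 2)"
    using s(2) by (intro mult_left_mono sum_le_exp) auto
  finally show ?thesis .
qed

text \<open>Common core of both tail estimates: \<open>c\<close> is the coefficient sequence of exp
  (u x) or of cosh (u x), and \<open>L\<close> is the value of that function at \<theta>. On
  \<open>E\<close> one eigenvalue makes the truncated series at least as large as at \<theta>, and
  by \<open>nonneg\<close> the others add at least 0, so the trace dominates. Markov's inequality is
  used at each fixed degree 2N; only the resulting numerical bounds pass to the limit.\<close>

lemma tail_bound:
  fixes M :: "'a measure" and Z :: "'a \<Rightarrow> 'i \<Rightarrow> real"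
  assumes M: "prob_space M"
    and Z: "(\<lambda>\<omega>. \<lambda>i\<in>I. Z \<omega> i) \<in> measurable M P" "distr M P (\<lambda>\<omega>. \<lambda>i\<in>I. Z \<omega> i) = P"
    and E: "E \<subseteq> space M"
    and s: "\<And>e. eigenvalue V e \<Longrightarrow> Re e \<le> s" "0 \<le> s"
    and c: "\<And>k. 0 \<le> c k" "\<And>k. c k \<le> u ^ k / fact k"
    and nonneg: "\<And>N x. 0 \<le> (\<Sum>k\<le>2 * N. c k * x ^ k)"
    and ev: "\<And>\<omega>. \<omega> \<in> E \<Longrightarrow> \<exists>\<nu> :: nat \<Rightarrow> real. (\<forall>a. mat_trace (X (Z \<omega>) ^\<^sub>m a) = of_real (\<Sum>j<n. \<nu> j ^ a)) \<and>
        (\<exists>j<n. \<forall>N. (\<Sum>k\<le>2 * N. c k * \<theta> ^ k) \<le> (\<Sum>k\<le>2 * N. c k * \<nu> j ^ k))"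
    and L: "(\<lambda>k. c k * \<theta> ^ k) sums L"
  shows "measure M E * L \<le> real n * exp (u\<^sup>2 * s / 2)"
proof -
  interpret prob_space M by fact
  define T where "T N z = (\<Sum>k\<le>2 * N. c k * Re (mat_trace (X z ^\<^sub>m k)))" for N z
  have T_eq: "T N z = (\<Sum>j<n. \<Sum>k\<le>2 * N. c k * \<nu> j ^ k)"
    if "\<And>a. mat_trace (X z ^\<^sub>m a) = of_real (\<Sum>j<n. \<nu> j ^ a)" for \<nu> :: "nat \<Rightarrow> real" and N z
    unfolding T_def that by (subst sum.swap) (simp add: sum_distrib_left)
  have T_nonneg: "0 \<le> T N z" for N z
  proof -
    obtain \<nu> :: "nat \<Rightarrow> real" where "\<And>a. mat_trace (X z ^\<^sub>m a) = of_real (\<Sum>j<n. \<nu> j ^ a)"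
      using hermitian_mat_pow_trace[OF X_carrier X_hermitian] by metis
    then show ?thesis using T_eq nonneg by (simp add: sum_nonneg)
  qed
  have T_int: "integrable P (T N)" for N
    unfolding T_def using integrable_trace_X_pow by simp
  \<comment> \<open>Points of the product space are undefined outside \<open>I\<close>, whereas
    \<open>Z \<omega>\<close> is arbitrary there; \<open>X\<close> reads only coordinates in
    \<open>I\<close>.\<close>
  have T_restrict: "T N (\<lambda>i\<in>I. Z \<omega> i) = T N (Z \<omega>)" for N \<omega>
    unfolding T_def by (simp add: X_cong[of "restrict (Z \<omega>) I" "Z \<omega>"])
  have TZ: "integrable M (\<lambda>\<omega>. T N (Z \<omega>))" "expectation (\<lambda>\<omega>. T N (Z \<omega>)) = (\<integral>z. T N z \<partial>P)" for N
  proof -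
    have T': "T N \<in> borel_measurable P" using T_int by auto
    have "integrable (distr M P (\<lambda>\<omega>. \<lambda>i\<in>I. Z \<omega> i)) (T N)"
      unfolding Z(2) by (rule T_int)
    then show "integrable M (\<lambda>\<omega>. T N (Z \<omega>))"
      unfolding integrable_distr_eq[OF Z(1) T'] T_restrict .
    show "expectation (\<lambda>\<omega>. T N (Z \<omega>)) = (\<integral>z. T N z \<partial>P)"
      using integral_distr[OF Z(1) T'] unfolding Z(2) T_restrict by simp
  qed
  have bound: "prob E * (\<Sum>k\<le>2 * N. c k * \<theta> ^ k) \<le> real n * exp (u\<^sup>2 * s / 2)" for N
  proof -
    have "prob E * (\<Sum>k\<le>2 * N. c k * \<theta> ^ k) \<le> expectation (\<lambda>\<omega>. T N (Z \<omega>))"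
    proof (rule markov_inequality_subset[OF E TZ(1) T_nonneg])
      fix \<omega> assume "\<omega> \<in> E"
      from ev[OF this] obtain \<nu> :: "nat \<Rightarrow> real" and j where
        \<nu>: "\<And>a. mat_trace (X (Z \<omega>) ^\<^sub>m a) = of_real (\<Sum>j<n. \<nu> j ^ a)" and
        j: "j < n" "\<And>N. (\<Sum>k\<le>2 * N. c k * \<theta> ^ k) \<le> (\<Sum>k\<le>2 * N. c k * \<nu> j ^ k)"
        by blast
      have "(\<Sum>k\<le>2 * N. c k * \<nu> j ^ k) \<le> (\<Sum>j<n. \<Sum>k\<le>2 * N. c k * \<nu> j ^ k)"
        using j(1) nonneg by (intro member_le_sum) auto
      then show "(\<Sum>k\<le>2 * N. c k * \<theta> ^ k) \<le> T N (Z \<omega>)"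
        using j(2)[of N] T_eq[OF \<nu>, of N] by linarith
    qed
    also have "\<dots> = (\<Sum>k\<le>2 * N. c k * moment k)"
      unfolding TZ(2) unfolding T_def moment_def using integrable_trace_X_pow by simp
    also have "\<dots> \<le> real n * exp (u\<^sup>2 * s / 2)"
      by (rule weighted_moments_le[OF s c])
    finally show ?thesis .
  qed
  have "strict_mono (\<lambda>N::nat. 2 * N)"
    by (auto simp: strict_mono_def)
  then have "(\<lambda>N. \<Sum>k\<le>2 * N. c k * \<theta> ^ k) \<longlonglongrightarrow> L"
    using LIMSEQ_subseq_LIMSEQ[of "\<lambda>N. \<Sum>k\<le>N. c k * \<theta> ^ k" L "\<lambda>N. 2 * N"] L
    by (simp add: sums_def_le o_def)
  then have "(\<lambda>N. prob E * (\<Sum>k\<le>2 * N. c k * \<theta> ^ k)) \<longlonglongrightarrow> prob E * L"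
    by (rule tendsto_mult_left)
  then show ?thesis
    by (rule LIMSEQ_le_const2) (use bound in blast)
qed

lemma eigenvalue_tail:
  fixes M :: "'a measure" and Z :: "'a \<Rightarrow> 'i \<Rightarrow> real"
  assumes M: "prob_space M"
    and Z: "(\<lambda>\<omega>. \<lambda>i\<in>I. Z \<omega> i) \<in> measurable M P" "distr M P (\<lambda>\<omega>. \<lambda>i\<in>I. Z \<omega> i) = P"
    and n: "n > 0" and \<theta>: "0 \<le> \<theta>"
  shows "measure M {\<omega> \<in> space M. Max (Re ` {e. eigenvalue (X (Z \<omega>)) e}) \<ge> \<theta>}
      \<le> real n * exp (- \<theta>\<^sup>2 / (2 * spec_norm V))" (is "measure M ?E \<le> _")
    and "measure M {\<omega> \<in> space M. spec_norm (X (Z \<omega>)) \<ge> \<theta>}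
      \<le> 2 * real n * exp (- \<theta>\<^sup>2 / (2 * spec_norm V))" (is "measure M ?F \<le> _")
proof -
  interpret prob_space M by fact
  define s where "s = spec_norm V"
  have s0: "0 \<le> s" and s: "\<And>e. eigenvalue V e \<Longrightarrow> Re e \<le> s"
  proof -
    obtain \<nu> :: "nat \<Rightarrow> real" where \<nu>: "{e. eigenvalue V e} = (\<lambda>k. of_real (\<nu> k)) ` {..<n}"
      "spec_norm V = Max ((\<lambda>k. \<bar>\<nu> k\<bar>) ` {..<n})"
      using hermitian_spec_norm[OF V_carrier V_hermitian n] by metis
    have le: "\<bar>\<nu> k\<bar> \<le> s" if "k < n" for k
      unfolding s_def \<nu>(2) using that by (intro Max_ge) auto
    show "0 \<le> s" using le[OF n] by linarith
    fix e assume "eigenvalue V e"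
    then obtain k where "k < n" "e = of_real (\<nu> k)" using \<nu>(1) by blast
    then show "Re e \<le> s" using le[of k] by simp
  qed
  have "prob ?E \<le> real n * exp (- \<theta>\<^sup>2 / (2 * s)) \<and> prob ?F \<le> 2 * real n * exp (- \<theta>\<^sup>2 / (2 * s))"
  proof (cases "s = 0")
    case True
    \<comment> \<open>Division by zero yields 0, so the right sides become \<open>real n\<close> and
      \<open>2 * real n\<close>, which are at least 1.\<close>
    have "prob ?E \<le> real n" "prob ?F \<le> 2 * real n"
      using n by (intro order_trans[OF prob_le_1]; simp)+
    then show ?thesis unfolding True by simp
  next
    case False
    with s0 have spos: "0 < s" by simp
    define u where "u = \<theta> / s"
    have u: "0 \<le> u" using \<theta> spos by (simp add: u_def)
    have exponent: "exp (u\<^sup>2 * s / 2) = exp (- \<theta>\<^sup>2 / (2 * s)) * exp (u * \<theta>)"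
      unfolding exp_add[symmetric] u_def using spos
      by (simp add: field_simps power2_eq_square)
    note tail = tail_bound[OF M Z _ s s0, where u = u and \<theta> = \<theta>]
    have "prob ?E * exp (u * \<theta>) \<le> real n * exp (u\<^sup>2 * s / 2)"
    proof (rule tail[where c = "\<lambda>k. u ^ k / fact k"])
      show "0 \<le> (\<Sum>k\<le>2 * N. u ^ k / fact k * x ^ k)" for N x
        using even_exp_truncation_nonneg[of "u * x" N] by (simp add: power_mult_distrib)
      show "(\<lambda>k. u ^ k / fact k * \<theta> ^ k) sums exp (u * \<theta>)"
        using exp_converges[of "u * \<theta>"] by (simp add: power_mult_distrib field_simps)
      fix \<omega> assume "\<omega> \<in> ?E"
      then have Max: "Max (Re ` {e. eigenvalue (X (Z \<omega>)) e}) \<ge> \<theta>" by simp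
      obtain \<nu> :: "nat \<Rightarrow> real" where \<nu>: "\<And>a. mat_trace (X (Z \<omega>) ^\<^sub>m a) = of_real (\<Sum>k<n. \<nu> k ^ a)"
        "{e. eigenvalue (X (Z \<omega>)) e} = (\<lambda>k. of_real (\<nu> k)) ` {..<n}"
        using hermitian_spec_norm[OF X_carrier X_hermitian n] by metis
      have "Max (\<nu> ` {..<n}) \<ge> \<theta>" using Max unfolding \<nu>(2) by (simp add: image_image)
      then obtain j where j: "j < n" "\<theta> \<le> \<nu> j"
        using n by (subst (asm) Max_ge_iff) auto
      have "(\<Sum>k\<le>2 * N. u ^ k / fact k * \<theta> ^ k) \<le> (\<Sum>k\<le>2 * N. u ^ k / fact k * \<nu> j ^ k)" for N
        using j \<theta> u by (intro sum_mono mult_left_mono power_mono) auto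
      with \<nu>(1) j show "\<exists>\<nu> :: nat \<Rightarrow> real. (\<forall>a. mat_trace (X (Z \<omega>) ^\<^sub>m a) = of_real (\<Sum>j<n. \<nu> j ^ a)) \<and>
          (\<exists>j<n. \<forall>N. (\<Sum>k\<le>2 * N. u ^ k / fact k * \<theta> ^ k) \<le> (\<Sum>k\<le>2 * N. u ^ k / fact k * \<nu> j ^ k))"
        by blast
    qed (use u in auto)
    then have E: "prob ?E \<le> real n * exp (- \<theta>\<^sup>2 / (2 * s))"
      unfolding exponent by (simp flip: mult.assoc)
    \<comment> \<open>Only even powers remain, and they depend on |\<nu> j| alone, so that large
      negative eigenvalues count as well.\<close>
    let ?c = "\<lambda>k. if even k then u ^ k / fact k else 0 :: real"
    have "prob ?F * cosh (u * \<theta>) \<le> real n * exp (u\<^sup>2 * s / 2)"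
    proof (rule tail[where c = ?c])
      show "0 \<le> (\<Sum>k\<le>2 * N. ?c k * x ^ k)" for N x
        using u by (intro sum_nonneg) (auto simp: zero_le_even_power)
      have "(\<lambda>k. ?c k * \<theta> ^ k) = (\<lambda>k. if even k then (u * \<theta>) ^ k /\<^sub>R fact k else 0)"
        by (auto simp: power_mult_distrib field_simps)
      then show "(\<lambda>k. ?c k * \<theta> ^ k) sums cosh (u * \<theta>)"
        using cosh_converges[of "u * \<theta>"] by simp
      fix \<omega> assume "\<omega> \<in> ?F"
      then have Max: "spec_norm (X (Z \<omega>)) \<ge> \<theta>" by simp
      obtain \<nu> :: "nat \<Rightarrow> real" where \<nu>: "\<And>a. mat_trace (X (Z \<omega>) ^\<^sub>m a) = of_real (\<Sum>k<n. \<nu> k ^ a)"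
        "spec_norm (X (Z \<omega>)) = Max ((\<lambda>k. \<bar>\<nu> k\<bar>) ` {..<n})"
        using hermitian_spec_norm[OF X_carrier X_hermitian n] by metis
      obtain j where j: "j < n" "\<theta> \<le> \<bar>\<nu> j\<bar>"
        using Max n unfolding \<nu>(2) by (subst (asm) Max_ge_iff) auto
      have "?c k * \<theta> ^ k \<le> ?c k * \<nu> j ^ k" for k
      proof (cases "even k")
        case True
        have "\<theta> ^ k \<le> \<bar>\<nu> j\<bar> ^ k" using j \<theta> by (intro power_mono) auto
        then have "\<theta> ^ k \<le> \<nu> j ^ k" using True by (simp add: power_even_abs)
        then have "u ^ k / fact k * \<theta> ^ k \<le> u ^ k / fact k * \<nu> j ^ k"
          by (rule mult_left_mono) (use u in simp)
        then show ?thesis by (simp only: True if_True)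
      qed simp
      then have "(\<Sum>k\<le>2 * N. ?c k * \<theta> ^ k) \<le> (\<Sum>k\<le>2 * N. ?c k * \<nu> j ^ k)" for N
        by (intro sum_mono)
      with \<nu>(1) j(1) show "\<exists>\<nu> :: nat \<Rightarrow> real. (\<forall>a. mat_trace (X (Z \<omega>) ^\<^sub>m a) = of_real (\<Sum>j<n. \<nu> j ^ a)) \<and>
          (\<exists>j<n. \<forall>N. (\<Sum>k\<le>2 * N. ?c k * \<theta> ^ k) \<le> (\<Sum>k\<le>2 * N. ?c k * \<nu> j ^ k))"
        by blast
    qed (use u in auto)
    \<comment> \<open>The additional factor 2 in the norm bound arises here.\<close>
    moreover have "exp (u * \<theta>) / 2 \<le> cosh (u * \<theta>)"
      by (simp add: cosh_def)
    then have "prob ?F * (exp (u * \<theta>) / 2) \<le> prob ?F * cosh (u * \<theta>)"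
      by (intro mult_left_mono) auto
    ultimately have "prob ?F * exp (u * \<theta>) \<le> 2 * (real n * (exp (- \<theta>\<^sup>2 / (2 * s)) * exp (u * \<theta>)))"
      unfolding exponent by linarith
    then have "prob ?F * exp (u * \<theta>) \<le> (2 * real n * exp (- \<theta>\<^sup>2 / (2 * s))) * exp (u * \<theta>)"
      by (simp only: mult.assoc)
    then have "prob ?F \<le> 2 * real n * exp (- \<theta>\<^sup>2 / (2 * s))"
      by (rule mult_right_le_imp_le) simp
    with E show ?thesis by simp
  qed
  then show "prob ?E \<le> real n * exp (- \<theta>\<^sup>2 / (2 * spec_norm V))"
    "prob ?F \<le> 2 * real n * exp (- \<theta>\<^sup>2 / (2 * spec_norm V))"
    unfolding s_def by blast+
qed

end

section \<open>Block circulant matrices\<close>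

lemma mod_sub_cases:
  fixes x t p :: nat
  assumes "x < p" "t < p"
  shows "(x + p - t) mod p = (if t \<le> x then x - t else x + p - t)"
proof (cases "t \<le> x")
  case True
  then have "x + p - t = (x - t) + p" by simp
  then have "(x + p - t) mod p = (x - t) mod p" by (simp only: mod_add_self2)
  then show ?thesis using True assms by simp
qed (use assms in auto)

text \<open>Shift the summation index by \<open>y\<close> modulo \<open>p\<close>. The convolution
  depends on \<open>x\<close> and \<open>y\<close> only through their cyclic difference, which is
  why a product of block circulant matrices is block circulant.\<close>

lemma cyclic_convolution_shift:
  fixes f g :: "nat \<Rightarrow> 'a :: comm_semiring_0"
  assumes "x < p" "y < p"
  shows "(\<Sum>t<p. f ((x + p - t) mod p) * g ((t + p - y) mod p)) =
    (\<Sum>t<p. f (((x + p - y) mod p + p - t) mod p) * g t)"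
proof (rule sum.reindex_bij_witness[of _ "\<lambda>t. if t + y < p then t + y else t + y - p" "\<lambda>t. (t + p - y) mod p"])
  fix t assume t: "t \<in> {..<p}"
  have less: "(t + p - y) mod p < p" "(x + p - y) mod p < p" using assms by auto
  show "(if (t + p - y) mod p + y < p then (t + p - y) mod p + y else (t + p - y) mod p + y - p) = t"
    using t assms by (auto simp: mod_sub_cases)
  show "(t + p - y) mod p \<in> {..<p}" using less by simp
  show "f (((x + p - y) mod p + p - (t + p - y) mod p) mod p) * g ((t + p - y) mod p) =
      f ((x + p - t) mod p) * g ((t + p - y) mod p)"
    unfolding mod_sub_cases[OF less(2,1)] using t assms
    by (auto simp: mod_sub_cases intro!: arg_cong[of _ _ "\<lambda>z. f z * _"])
next
  fix t assume t: "t \<in> {..<p}"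
  let ?s = "if t + y < p then t + y else t + y - p"
  have "?s < p" using t assms by auto
  then show "?s \<in> {..<p}" by simp
  show "(?s + p - y) mod p = t"
    unfolding mod_sub_cases[OF \<open>?s < p\<close> assms(2)] using t assms by auto
qed

lemma bcirc_carrier [simp]: "bcirc m n p A \<in> carrier_mat (m * p) (n * p)"
  by (simp add: bcirc_def)

lemma dim_bcirc [simp]: "dim_row (bcirc m n p A) = m * p" "dim_col (bcirc m n p A) = n * p"
  by (simp_all add: bcirc_def)

lemma index_bcirc:
  "a < m * p \<Longrightarrow> b < n * p \<Longrightarrow>
    bcirc m n p A $$ (a, b) = A (a mod m) (b mod n) ((a div m + p - b div n) mod p)"
  by (simp add: bcirc_def)

text \<open>A column index of the left factor splits as t n + l into a block t and a position l
  inside it. The sum over t is a cyclic convolution, and shifting it moves the entry to the first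
  block column, from which \<open>tprod\<close> is read off.\<close>

lemma bcirc_tprod: "bcirc m q p (tprod n p A B) = bcirc m n p A * bcirc n q p B"
proof (rule eq_matI)
  fix a b assume "a < dim_row (bcirc m n p A * bcirc n q p B)" "b < dim_col (bcirc m n p A * bcirc n q p B)"
  then have ab: "a < m * p" "b < q * p" by (auto simp: bcirc_def)
  then have less: "a div m < p" "b div q < p"
    by (simp_all add: less_mult_imp_div_less mult.commute)
  define h where "h l t = A (a mod m) l ((a div m + p - t) mod p) * B l (b mod q) ((t + p - b div q) mod p)" for l t
  have "(bcirc m n p A * bcirc n q p B) $$ (a, b) = (\<Sum>c<n * p. h (c mod n) (c div n))"
    using ab by (simp add: bcirc_def scalar_prod_def atLeast0LessThan h_def)
  also have "\<dots> = (\<Sum>(l, t)\<in>{..<n} \<times> {..<p}. h l t)"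
  proof (rule sum.reindex_bij_witness[of _ "\<lambda>(l, t). t * n + l" "\<lambda>c. (c mod n, c div n)"])
    fix c assume c: "c \<in> {..<n * p}"
    then have "n > 0" by (cases n) auto
    then show "(c mod n, c div n) \<in> {..<n} \<times> {..<p}"
      using c by (simp add: less_mult_imp_div_less mult.commute)
  next
    fix z assume z: "z \<in> {..<n} \<times> {..<p}"
    obtain l t where lt: "z = (l, t)" "l < n" "t < p" using z by auto
    have "t * n + l < Suc t * n" using lt by simp
    also have "\<dots> \<le> p * n" using lt by (intro mult_right_mono) auto
    finally show "(case z of (l, t) \<Rightarrow> t * n + l) \<in> {..<n * p}"
      using lt by (simp add: mult.commute)
  qed auto
  also have "\<dots> = (\<Sum>l<n. \<Sum>t<p. h l t)"
    by (simp add: sum.cartesian_product)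
  also have "\<dots> = (\<Sum>l<n. \<Sum>t<p. A (a mod m) l (((a div m + p - b div q) mod p + p - t) mod p) * B l (b mod q) t)"
    unfolding h_def by (intro sum.cong refl cyclic_convolution_shift less)
  also have "\<dots> = bcirc m q p (tprod n p A B) $$ (a, b)"
    using ab by (simp add: bcirc_def tprod_def)
  finally show "bcirc m q p (tprod n p A B) $$ (a, b) = (bcirc m n p A * bcirc n q p B) $$ (a, b)" ..
qed (auto simp: bcirc_def)

text \<open>Transposing swaps the block indices and so negates their cyclic difference k; the slice
  number \<open>(p - k) mod p\<close> in \<open>tconj\<close> is this negative.\<close>

lemma bcirc_hermitian:
  assumes "hermitian_tensor m p A"
  shows "mat_adjoint (bcirc m m p A) = bcirc m m p A"
proof (rule eq_matI)
  fix a b assume "a < dim_row (bcirc m m p A)" "b < dim_col (bcirc m m p A)"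
  then have ab: "a < m * p" "b < m * p" by (auto simp: bcirc_def)
  then have m: "m > 0" by (cases m) auto
  have less: "a div m < p" "b div m < p"
    using ab by (simp_all add: less_mult_imp_div_less mult.commute)
  define k where "k = (a div m + p - b div m) mod p"
  have k: "k < p" using less by (simp add: k_def)
  have "(p - k) mod p = (b div m + p - a div m) mod p"
    unfolding k_def using less by (auto simp: mod_sub_cases)
  moreover have "cnj (A (b mod m) (a mod m) ((p - k) mod p)) = A (a mod m) (b mod m) k"
    using assms m k unfolding hermitian_tensor_def tconj_def by simp
  ultimately show "mat_adjoint (bcirc m m p A) $$ (a, b) = bcirc m m p A $$ (a, b)"
    using ab by (simp add: bcirc_def k_def)
qed (auto simp: bcirc_def)

text \<open>Transports the variables to the product space on which the moments are computed.
  \<open>\<mu>\<close> is tied to their laws on \<open>I\<close> only, which leaves room for default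
  laws elsewhere.\<close>

lemma (in prob_space) distr_indep_vars_PiM:
  fixes \<alpha> :: "'i \<Rightarrow> 'a \<Rightarrow> real"
  assumes indep: "indep_vars (\<lambda>_. borel) \<alpha> I" and I: "I \<noteq> {}"
    and \<mu>: "\<And>i. i \<in> I \<Longrightarrow> \<mu> i = distr M borel (\<alpha> i)"
  shows "(\<lambda>\<omega>. \<lambda>i\<in>I. \<alpha> i \<omega>) \<in> measurable M (Pi\<^sub>M I \<mu>)"
    and "distr M (Pi\<^sub>M I \<mu>) (\<lambda>\<omega>. \<lambda>i\<in>I. \<alpha> i \<omega>) = Pi\<^sub>M I \<mu>"
proof -
  have rv: "\<alpha> i \<in> borel_measurable M" if "i \<in> I" for i
    using indep that by (auto simp: indep_vars_def)
  have sets: "sets (Pi\<^sub>M I \<mu>) = sets (Pi\<^sub>M I (\<lambda>_. borel))"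
    by (intro sets_PiM_cong) (auto simp: \<mu>)
  have "(\<lambda>\<omega>. \<lambda>i\<in>I. \<alpha> i \<omega>) \<in> measurable M (Pi\<^sub>M I (\<lambda>_. borel))"
    by (intro measurable_restrict rv)
  then show "(\<lambda>\<omega>. \<lambda>i\<in>I. \<alpha> i \<omega>) \<in> measurable M (Pi\<^sub>M I \<mu>)"
    using measurable_cong_sets[OF refl sets] by blast
  have "distr M (Pi\<^sub>M I \<mu>) (\<lambda>\<omega>. \<lambda>i\<in>I. \<alpha> i \<omega>) = distr M (Pi\<^sub>M I (\<lambda>_. borel)) (\<lambda>\<omega>. \<lambda>i\<in>I. \<alpha> i \<omega>)"
    by (intro distr_cong sets refl)
  also have "\<dots> = Pi\<^sub>M I (\<lambda>i. distr M borel (\<alpha> i))"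
    using indep_vars_iff_distr_eq_PiM'[OF I, where M' = "\<lambda>_. borel" and X = \<alpha>] rv indep by simp
  also have "\<dots> = Pi\<^sub>M I \<mu>"
    by (intro PiM_cong) (auto simp: \<mu>)
  finally show "distr M (Pi\<^sub>M I \<mu>) (\<lambda>\<omega>. \<lambda>i\<in>I. \<alpha> i \<omega>) = Pi\<^sub>M I \<mu>" .
qed

theorem theorem1:
  fixes M :: "'a measure" and m p n :: nat
    and As :: "nat \<Rightarrow> tensor" and \<alpha> :: "nat \<Rightarrow> 'a \<Rightarrow> real"
  assumes "prob_space M"
    and "m \<ge> 1" and "p \<ge> 1" and "n \<ge> 1"
    and herm: "\<forall>i<n. hermitian_tensor m p (As i)"
    and indep: "prob_space.indep_vars M (\<lambda>_. borel) \<alpha> {..<n}"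
    and distr: "(\<forall>i<n. std_gaussian_rv M (\<alpha> i)) \<or> (\<forall>i<n. rademacher_rv M (\<alpha> i))"
  shows "\<forall>\<theta>::real. \<theta> \<ge> 0 \<longrightarrow>
    (let S = (\<lambda>\<omega>. \<lambda>a b k. \<Sum>i<n. complex_of_real (\<alpha> i \<omega>) * As i a b k);
         \<sigma>2 = tnorm m m p (\<lambda>a b k. \<Sum>i<n. tprod m p (As i) (As i) a b k)
     in measure M {\<omega> \<in> space M. tlambda_max m p (S \<omega>) \<ge> \<theta>}
          \<le> real (m * p) * exp (- \<theta>\<^sup>2 / (2 * \<sigma>2))
      \<and> measure M {\<omega> \<in> space M. tnorm m m p (S \<omega>) \<ge> \<theta>}
          \<le> 2 * real (m * p) * exp (- \<theta>\<^sup>2 / (2 * \<sigma>2)))"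
proof -
  interpret prob_space M by fact
  \<comment> \<open>Indices from n on receive the law of \<open>\<alpha> 0\<close>, available since
    n >= 1, because \<open>stein_matrix_series\<close> asks for a law at every index.\<close>
  define \<mu> where "\<mu> i = distr M borel (\<alpha> (if i < n then i else 0))" for i
  have law: "stein_law (\<mu> i)" for i
  proof -
    have "(if i < n then i else 0) < n" using \<open>n \<ge> 1\<close> by simp
    then show ?thesis
      unfolding \<mu>_def using distr stein_law_gaussian stein_law_rademacher by blast
  qed
  interpret stein_matrix_series "{..<n}" \<mu> "\<lambda>i. bcirc m m p (As i)" "m * p"
    using law herm by unfold_locales (auto simp: bcirc_hermitian)
  \<comment> \<open>\<open>bcirc\<close> is linear in the tensor, so the matrix series is the block
    circulant matrix of the tensor series.\<close>
  have X_eq: "X (\<lambda>i. \<alpha> i \<omega>) = bcirc m m p (\<lambda>a b k. \<Sum>i<n. complex_of_real (\<alpha> i \<omega>) * As i a b k)" for \<omega>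
    by (intro eq_matI) (auto simp: X_def index_bcirc)
  have "V = bcirc m m p (\<lambda>a b k. \<Sum>i<n. tprod m p (As i) (As i) a b k)"
    by (intro eq_matI) (auto simp: V_def index_bcirc simp flip: bcirc_tprod)
  then have V_eq: "spec_norm V = tnorm m m p (\<lambda>a b k. \<Sum>i<n. tprod m p (As i) (As i) a b k)"
    by (simp add: tnorm_def)
  have "m * p > 0" "{..<n} \<noteq> {}"
    using \<open>m \<ge> 1\<close> \<open>p \<ge> 1\<close> \<open>n \<ge> 1\<close> by (auto simp: lessThan_empty_iff)
  note Z = distr_indep_vars_PiM[OF indep this(2), of \<mu>]
  have \<mu>: "\<mu> i = distr M borel (\<alpha> i)" if "i \<in> {..<n}" for i
    using that by (simp add: \<mu>_def)
  show ?thesis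
    using eigenvalue_tail[OF prob_space_axioms Z[OF \<mu>] \<open>m * p > 0\<close>]
    unfolding Let_def X_eq V_eq tlambda_max_def tnorm_def by blast
qed

end
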